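(* Let $S\subset\mathbb{R}^d$ ($d\ge 2$) be a bounded surface with metric tensor $\mathbb{M}$ satisfying $\underline{m}I\le \mathbb{M}(x)\le\overline{m}I$ for positive constants $\underline m,\overline m$, and let $I_h$ be a meshing function of the form $$I_h(\mathcal{T}_h)=\sum_{K\in\mathcal{T}_h}|\hat K|\,\det\big((F_K')^T\mathbb{M}_KF_K'\big)^{1/2}\,\tilde G(\mathbb{J}_K,r_K),\qquad \mathbb{J}_K=\big((F_K')^T\mathbb{M}_KF_K'\big)^{-1},\quad r_K=\det(\mathbb{J}_K),$$ where $\tilde G$ is a smooth function satisfying the coercivity condition $$\tilde G(\mathbb{J},\det \mathbb{J})\ \ge\ \alpha\,\big(\mathrm{tr}(\mathbb{J})\big)^q-\beta\qquad\text{for all symmetric positive definite }\mathbb{J}\in\mathbb{R}^{(d-1)\times(d-1)},$$ with constants $q>(d-1)/2$, $\alpha>0$, $\beta\ge 0$. Assume that the reference simplex $\hat K$ is equilateral with $|\hat K|=1/N$, where $N$ is the number of elements of the mesh. Let $\mathcal{T}_h(t)=(x_1(t),\dots,x_{N_v}(t))$ be the mesh trajectory of the surface moving mesh equation $$\frac{dx_i}{dt}=-\frac{P_i}{\tau}\left[\Big(\frac{\partial I_h}{\partial x_i}\Big)^T-\Big(\Big(\frac{\partial I_h}{\partial x_i}\Big)^T\cdot n_i\Big)n_i\right],\qquad i=1,\dots,N_v,$$ starting from the initial mesh $\mathcal{T}_h(0)$. If all elements of the mesh have positive areas at $t=0$, then they have positive areas for all time $t>0$. Moreover, for all time and every element $K$,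 the minimum altitude $a_{K,\mathbb{M}_K}$ of $K$ in the metric $\mathbb{M}_K$ and the Euclidean area $|K|$ of $K$ satisfy $$a_{K,\mathbb{M}_K}\ \ge\ C_1\left[I_h(\mathcal{T}_h(0))+\beta\,\overline{m}^{\,d/2}|S|\right]^{-\frac{1}{2q-d+1}}N^{-\frac{2q}{(d-1)(2q-d+1)}},$$ $$|K|\ \ge\ C_2\left[I_h(\mathcal{T}_h(0))+\beta\,\overline{m}^{\,d/2}|S|\right]^{-\frac{d-1}{2q-d+1}}N^{-\frac{2q}{2q-d+1}}\,\overline{m}^{\,-\frac d2},$$ where $$C_1=\left(\frac{\alpha\, d^{\frac{q(d-2)}{d-1}}\,\big((d-1)!\big)^{\frac{2q-d+1}{d-1}}}{(d-1)^{\frac{d-1+2q}{2}}}\right)^{\frac{1}{2q-d+1}},\qquad C_2=\frac{C_1^{d-1}}{(d-1)^{\frac{d-1}{2}}(d-1)!}.$$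
   Context: $S=\{x:\Phi(x)=0\}$ is a bounded surface (hypersurface) in $\mathbb{R}^d$; $|S|$ denotes its area. A mesh $\mathcal{T}_h=\{K\}$ on $S$ consists of $N$ elements and $N_v$ vertices $x_1,\dots,x_{N_v}\in S$; each element $K$ is a (flat) $(d-1)$-dimensional simplex in $\mathbb{R}^d$ with vertices $x_1^K,\dots,x_d^K$ among the mesh vertices. The connectivity of the mesh is fixed; only the vertices move. $|K|$ is the $(d-1)$-dimensional Euclidean area of $K$. $\hat K\subset\mathbb{R}^{d-1}$ is the reference $(d-1)$-simplex with vertices $\xi_1,\dots,\xi_d$ and volume $|\hat K|$. $F_K:\hat K\to K$ is the affine map with $F_K(\xi_j)=x_j^K$, and $F_K'\in\mathbb{R}^{d\times(d-1)}$ is its Jacobian matrix, $F_K'=E_K\hat E^{-1}$ with $E_K=[x_2^K-x_1^K,\dots,x_d^K-x_1^K]$ and $\hat E=[\xi_2-\xi_1,\dots,\xi_d-\xi_1]$. $\mathbb{M}(x)$ is a symmetric $d\times d$ matrix-valued function (metric tensor) with $\underline{m}I\le\mathbb{M}(x)\le\overline{m}I$ (in the sense of semi-definiteness), defined at the points where it is evaluated (on $S$ and on the elements of the mesh). $\mathbb{M}_K=\frac{1}{|K|}\int_K\mathbb{M}(x)\,dx$ is its average over $K$. Geometric quantities of $K$ in the metric $\mathbb{M}_K$ are those of the simplex $\mathbb{M}_K^{1/2}K$ in the Euclidean metric; in particular $a_{K,\mathbb{M}_K}$ is the minimum altitude of $\mathbb{M}_K^{1/2}K$, an altitude being the distance from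 a vertex to the affine hull of the opposite face. $I_h$ is regarded as a function of the vertex coordinates $(x_1,\dots,x_{N_v})$, and $\partial I_h/\partial x_i$ is its gradient (row vector) with respect to $x_i\in\mathbb{R}^d$. In the moving mesh equation $P_i$ is a positive scalar function, $\tau>0$ is a constant, and $n_i=\nabla\Phi(x_i)/\|\nabla\Phi(x_i)\|$ is the unit normal to $S$ at $x_i$. The equation is applied to all vertices (no modification for boundary vertices is considered); the vertices stay on $S$.
   Formalization: The upper metric bound is taken to be at least 1, and when β > 0 the total area of the mesh elements is assumed not to exceed |S| at all times; without these the stated bounds can fail (e.g. small metric bound on an inscribed polygon, or a pentagram inscribed in a circle). *)

theory Defs
  imports "HOL-Analysis.Analysis"
begin

text \<open>
  Conventions. The ambient space is \<open>real^'d\<close>, the reference space is \<open>real^'n\<close>, and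
  \<open>CARD('d) = CARD('n) + 1\<close> is an assumption of the theorem (so \<open>d \<ge> 2\<close>). A simplex of
  dimension \<open>CARD('n)\<close> is given by its vertices, indexed by \<open>'n option\<close>: \<open>None\<close> is the base vertex
  (the first one in the usual numbering) and \<open>Some j\<close>, \<open>j :: 'n\<close>, are the other ones. The positions
  of all mesh vertices form one vector in \<open>real^'d^'v\<close>.
\<close>

section \<open>Smoothness and gradients\<close>

text \<open>For open sets only: derivatives are taken with respect to the full space.\<close>

primrec Ck_on :: "nat \<Rightarrow> 'a::real_normed_vector set \<Rightarrow> ('a \<Rightarrow> 'b::real_normed_vector) \<Rightarrow> bool" where
  "Ck_on 0 W f \<longleftrightarrow> continuous_on W f"
| "Ck_on (Suc k) W f \<longleftrightarrow> (\<forall>x\<in>W. f differentiable (at x)) \<and>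
     (\<forall>v. Ck_on k W (\<lambda>x. frechet_derivative f (at x) v))"

definition smooth_on :: "'a::real_normed_vector set \<Rightarrow> ('a \<Rightarrow> 'b::real_normed_vector) \<Rightarrow> bool" where
  "smooth_on W f \<longleftrightarrow> (\<forall>k. Ck_on k W f)"

definition gradient :: "('a::real_inner \<Rightarrow> real) \<Rightarrow> 'a \<Rightarrow> 'a" where
  "gradient f x = (THE D. GDERIV f x :> D)"

definition vertex_gradient :: "((real^'d)^'v \<Rightarrow> real) \<Rightarrow> (real^'d)^'v \<Rightarrow> 'v \<Rightarrow> real^'d" where
  "vertex_gradient F y i = gradient (\<lambda>z. F (\<chi> j. if j = i then z else y $ j)) (y $ i)"


section \<open>Symmetric matrices\<close>

definition psd :: "real^'m^'m \<Rightarrow> bool" where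
  "psd A \<longleftrightarrow> transpose A = A \<and> (\<forall>v. 0 \<le> v \<bullet> (A *v v))"

definition spd :: "real^'m^'m \<Rightarrow> bool" where
  "spd A \<longleftrightarrow> transpose A = A \<and> (\<forall>v. v \<noteq> 0 \<longrightarrow> 0 < v \<bullet> (A *v v))"

definition loewner_le :: "real^'m^'m \<Rightarrow> real^'m^'m \<Rightarrow> bool" where
  "loewner_le A B \<longleftrightarrow> psd (B - A)"

text \<open>Meaningful for positive semidefinite \<open>A\<close>, where the root exists and is unique.\<close>

definition psd_sqrt :: "real^'m^'m \<Rightarrow> real^'m^'m" where
  "psd_sqrt A = (SOME B. psd B \<and> B ** B = A)"


section \<open>Hypersurfaces and their area\<close>

text \<open>
  The \<open>k\<close>-dimensional Hausdorff measure (\<open>k \<ge> 1\<close>), normalised to agree with \<open>k\<close>-dimensional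
  Lebesgue measure on flat sets.
\<close>

definition hausdorff_measure :: "nat \<Rightarrow> 'a::metric_space set \<Rightarrow> ennreal" where
  "hausdorff_measure k A =
     (SUP \<delta>\<in>{0<..}. INF U\<in>{U :: nat \<Rightarrow> 'a set. A \<subseteq> (\<Union>i. U i) \<and>
                                    (\<forall>i. bounded (U i) \<and> diameter (U i) \<le> \<delta>)}.
        (\<Sum>i. ennreal (unit_ball_vol (real k) * (diameter (U i) / 2) ^ k)))"

definition level_surface :: "(real^'d \<Rightarrow> real) \<Rightarrow> (real^'d) set" where
  "level_surface \<Phi> = {x. \<Phi> x = 0}"

definition regular_hypersurface :: "(real^'d \<Rightarrow> real) \<Rightarrow> bool" where
  "regular_hypersurface \<Phi> \<longleftrightarrow> Ck_on 1 UNIV \<Phi> \<and> (\<forall>x \<in> level_surface \<Phi>. gradient \<Phi> x \<noteq> 0)"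

definition unit_normal :: "(real^'d \<Rightarrow> real) \<Rightarrow> real^'d \<Rightarrow> real^'d" where
  "unit_normal \<Phi> x = gradient \<Phi> x /\<^sub>R norm (gradient \<Phi> x)"

definition surface_area :: "(real^'d) set \<Rightarrow> real" where
  "surface_area S = enn2real (hausdorff_measure (CARD('d) - 1) S)"


section \<open>Flat simplices\<close>

definition flat_simplex :: "('n option \<Rightarrow> 'a::real_vector) \<Rightarrow> 'a set" where
  "flat_simplex v = convex hull (range v)"

definition equilateral :: "('n option \<Rightarrow> 'a::metric_space) \<Rightarrow> bool" where
  "equilateral v \<longleftrightarrow> (\<exists>s. \<forall>i j. i \<noteq> j \<longrightarrow> dist (v i) (v j) = s)"

definition simplex_volume :: "('n::finite option \<Rightarrow> real^'n) \<Rightarrow> real" where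
  "simplex_volume v = measure lborel (flat_simplex v)"

text \<open>
  The Euclidean area on a \<open>CARD('n)\<close>-dimensional affine subspace containing the simplex is Lebesgue
  measure transported by a distance-preserving parametrisation of that subspace. Areas of subsets of
  the simplex and integrals over it do not depend on the parametrisation chosen; if the simplex is
  degenerate, its area is 0. Parametrisations exist if \<open>CARD('n) \<le> CARD('d)\<close>.
\<close>

definition isometric_chart ::
  "('n::finite option \<Rightarrow> real^'d) \<Rightarrow> (real^'n \<Rightarrow> real^'d) \<Rightarrow> bool" where
  "isometric_chart v f \<longleftrightarrow> (\<forall>y z. dist (f y) (f z) = dist y z) \<and> range v \<subseteq> range f"

definition area_measure :: "('n::finite option \<Rightarrow> real^'d) \<Rightarrow> (real^'d) measure" where
  "area_measure v = distr lborel borel (SOME f. isometric_chart v f)"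

definition simplex_area :: "('n::finite option \<Rightarrow> real^'d) \<Rightarrow> real" where
  "simplex_area v = measure (area_measure v) (flat_simplex v)"

definition average_metric ::
  "(real^'d \<Rightarrow> real^'d^'d) \<Rightarrow> ('n::finite option \<Rightarrow> real^'d) \<Rightarrow> real^'d^'d" where
  "average_metric M v =
     (1 / simplex_area v) *\<^sub>R set_lebesgue_integral (area_measure v) (flat_simplex v) M"

definition edge_matrix :: "('n::finite option \<Rightarrow> real^'m) \<Rightarrow> real^'n^'m" where
  "edge_matrix v = (\<chi> r c. (v (Some c) - v None) $ r)"

text \<open>The Jacobian matrix of the affine map taking \<open>\<xi> j\<close> to \<open>v j\<close> for all \<open>j\<close>.\<close>

definition affine_jacobian ::
  "('n::finite option \<Rightarrow> real^'n) \<Rightarrow> ('n option \<Rightarrow> real^'d) \<Rightarrow> real^'n^'d" where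
  "affine_jacobian \<xi> v = edge_matrix v ** matrix_inv (edge_matrix \<xi>)"

definition altitude :: "('n option \<Rightarrow> real^'d) \<Rightarrow> 'n option \<Rightarrow> real" where
  "altitude v i = infdist (v i) (affine hull (v ` (UNIV - {i})))"

definition min_altitude :: "('n::finite option \<Rightarrow> real^'d) \<Rightarrow> real" where
  "min_altitude v = Min (range (altitude v))"

definition metric_min_altitude ::
  "(real^'d \<Rightarrow> real^'d^'d) \<Rightarrow> ('n::finite option \<Rightarrow> real^'d) \<Rightarrow> real" where
  "metric_min_altitude M v = min_altitude (\<lambda>j. psd_sqrt (average_metric M v) *v v j)"


section \<open>Meshes and meshing functions\<close>

text \<open>
  The connectivity \<open>conn\<close> assigns to each element (type \<open>'e\<close>) the mesh vertices (type \<open>'v\<close>) that are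
  its corners; \<open>element conn y k\<close> lists the corner positions when the vertices are at \<open>y\<close>.
\<close>

definition element ::
  "('e \<Rightarrow> 'n option \<Rightarrow> 'v) \<Rightarrow> (real^'d)^'v \<Rightarrow> 'e \<Rightarrow> 'n option \<Rightarrow> real^'d" where
  "element conn y k = (\<lambda>j. y $ conn k j)"

definition positive_areas ::
  "('e \<Rightarrow> 'n::finite option \<Rightarrow> 'v) \<Rightarrow> (real^'d)^'v \<Rightarrow> bool" where
  "positive_areas conn y \<longleftrightarrow> (\<forall>k. 0 < simplex_area (element conn y k))"

definition pullback_metric ::
  "('n::finite option \<Rightarrow> real^'n) \<Rightarrow> (real^'d \<Rightarrow> real^'d^'d) \<Rightarrow> ('n option \<Rightarrow> real^'d) \<Rightarrow> real^'n^'n"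
  where
  "pullback_metric \<xi> M v =
     transpose (affine_jacobian \<xi> v) ** average_metric M v ** affine_jacobian \<xi> v"

definition meshing_function ::
  "('n::finite option \<Rightarrow> real^'n) \<Rightarrow> (real^'d \<Rightarrow> real^'d^'d) \<Rightarrow> (real^'n^'n \<Rightarrow> real \<Rightarrow> real) \<Rightarrow>
   ('e::finite \<Rightarrow> 'n option \<Rightarrow> 'v) \<Rightarrow> (real^'d)^'v \<Rightarrow> real" where
  "meshing_function \<xi> M G conn y =
     (\<Sum>k\<in>UNIV. let A = pullback_metric \<xi> M (element conn y k); J = matrix_inv A
                in simplex_volume \<xi> * sqrt (det A) * G J (det J))"

definition projected_gradient ::
  "(real^'d \<Rightarrow> real) \<Rightarrow> ((real^'d)^'v \<Rightarrow> real) \<Rightarrow> (real^'d)^'v \<Rightarrow> 'v \<Rightarrow> real^'d" where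
  "projected_gradient \<Phi> F y i =
     (let g = vertex_gradient F y i; n = unit_normal \<Phi> (y $ i) in g - (g \<bullet> n) *\<^sub>R n)"


section \<open>The constants of the lower bounds\<close>

definition altitude_const :: "real \<Rightarrow> real \<Rightarrow> nat \<Rightarrow> real" where
  "altitude_const \<alpha> q d =
     (\<alpha> * real d powr (q * (real d - 2) / (real d - 1))
        * (fact (d - 1)) powr ((2 * q - real d + 1) / (real d - 1))
        / (real d - 1) powr ((real d - 1 + 2 * q) / 2)) powr (1 / (2 * q - real d + 1))"

definition area_const :: "real \<Rightarrow> real \<Rightarrow> nat \<Rightarrow> real" where
  "area_const \<alpha> q d =
     altitude_const \<alpha> q d ^ (d - 1) / ((real d - 1) powr ((real d - 1) / 2) * fact (d - 1))"

end

theory Submission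
  imports Defs
begin

text \<open>
  Write \<open>n = d - 1\<close>. For an element \<open>K\<close> with edge matrix \<open>E\<close> and averaged metric \<open>M_K\<close>, everything is
  governed by the Gram matrix \<open>A = E\<^sup>T M_K E\<close> of the edges of \<open>M_K\<^sup>1\<^sup>/\<^sup>2 K\<close>, and by the gradients \<open>g_i\<close> of the
  \<open>d\<close> barycentric coordinates of that simplex. The squared length of \<open>g_i\<close> is \<open>u_i \<bullet> A\<^sup>-\<^sup>1 u_i\<close>, where the
  \<open>u_i\<close> are the coordinate vectors and minus their sum, and the altitude at vertex \<open>i\<close> is at least
  \<open>1 / |g_i|\<close>. Put \<open>b = 1 / max |g_i|\<close>, a lower bound of all altitudes.

  The contribution of \<open>K\<close> to the meshing function is its area \<open>V\<close> in the metric times \<open>G\<close>, and coercivity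
  bounds it below by \<open>V (\<alpha> (trace J)^q - \<beta>)\<close>. Both factors are controlled by \<open>b\<close>. For an equilateral
  reference simplex with side \<open>s\<close> the trace of \<open>J\<close> equals \<open>s\<^sup>2 / 2\<close> times the sum of all \<open>|g_i|\<^sup>2\<close>, and since the
  \<open>g_i\<close> sum to zero this is at least \<open>(s\<^sup>2 / 2) (1 + 1 / n) / b\<^sup>2\<close>. The area satisfies \<open>n! V = (det A)\<^sup>1\<^sup>/\<^sup>2\<close>, and
  \<open>det A\<^sup>-\<^sup>1 \<le> (trace A\<^sup>-\<^sup>1)^n\<close> gives \<open>n! V \<ge> b^n n^(-n/2)\<close>. So a small \<open>b\<close> makes the contribution as large as a
  multiple of \<open>b^(n - 2 q)\<close>, which is unbounded because \<open>2 q > n\<close>. The terms with \<open>\<beta>\<close> add up to at most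
  \<open>\<beta> m_up^(d/2)\<close> times the total area, because \<open>V \<le> m_up^(n/2) |K|\<close>. Hence an upper bound of the meshing
  function is a lower bound of \<open>b\<close>, thus of the altitudes, and then of \<open>V\<close> and of \<open>|K|\<close>; with the side
  of a simplex of volume \<open>1 / N\<close> inserted, these are the stated constants
  (\<open>element_estimates\<close>, \<open>altitude_bound_from_energy\<close>, \<open>mesh_lower_bounds\<close>).

  The moving mesh equation is a gradient flow projected to the tangent spaces of the surface, so the meshing
  function does not increase as long as all areas are positive
  (\<open>projected_gradient_flow_derivative\<close>). Positivity is then kept by continuity: areas are continuous in
  time, and as long as they are positive they stay above one fixed positive bound, so they cannot reach zero
  (\<open>positive_if_positivity_improves\<close>).

  Two facts of linear algebra and measure theory carry the geometry: symmetric matrices have an orthonormal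
  eigenbasis, whence square roots, and the area of a flat simplex is \<open>1 / n!\<close> times the root of the
  determinant of its Gram matrix.
\<close>

section \<open>Spectral decomposition and square roots\<close>

lemma quadratic_nonneg_imp_linear_coeff_zero:
  fixes a b :: real
  assumes "\<And>t. 0 \<le> 2 * t * a + t\<^sup>2 * b"
  shows "a = 0"
proof (rule ccontr)
  assume "a \<noteq> 0"
  define c where "c = \<bar>b\<bar> + 1"
  define t where "t = - a / c"
  have "c > 0" "b < 2 * c"
    by (auto simp: c_def)
  then have "2 * t * a + t\<^sup>2 * b = (a\<^sup>2 / c\<^sup>2) * (b - 2 * c)"
    unfolding t_def by (simp add: field_simps power2_eq_square)
  moreover have "(a\<^sup>2 / c\<^sup>2) * (b - 2 * c) < 0"
    using \<open>a \<noteq> 0\<close> \<open>c > 0\<close> \<open>b < 2 * c\<close> by (intro mult_pos_neg) auto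
  ultimately show False
    using assms[of t] by linarith
qed

text \<open>
  A maximiser \<open>b\<close> of the quadratic form on the unit sphere of \<open>U\<close>, with maximum \<open>l\<close>, is an eigenvector: the form
  \<open>l (y \<bullet> y) - y \<bullet> f y\<close> is nonnegative on \<open>U\<close> and vanishes at \<open>b\<close>, so its first variation at \<open>b\<close>
  vanishes. Thus \<open>l b - f b\<close> is orthogonal to \<open>U\<close>, to which it belongs.
\<close>

lemma selfadjoint_eigenvector_exists:
  fixes f :: "'a::euclidean_space \<Rightarrow> 'a"
  assumes lin: "linear f" and sa: "\<And>x y. f x \<bullet> y = x \<bullet> f y"
    and U: "subspace U" "f ` U \<subseteq> U" "U \<noteq> {0}"
  obtains b where "b \<in> U" "norm b = 1" "f b = (b \<bullet> f b) *\<^sub>R b"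
proof -
  interpret linear f by fact
  let ?S = "U \<inter> sphere 0 1"
  obtain u where u: "u \<in> U" "u \<noteq> 0"
    using U subspace_0 by blast
  then have "u /\<^sub>R norm u \<in> ?S"
    using U(1) by (simp add: subspace_mul)
  moreover have "compact ?S"
    using closed_subspace[OF U(1)] by (simp add: closed_Int_compact)
  moreover have "continuous_on ?S (\<lambda>x. x \<bullet> f x)"
    using lin by (intro continuous_intros linear_continuous_on) (simp add: linear_conv_bounded_linear)
  ultimately obtain b where b: "b \<in> ?S" "\<And>y. y \<in> ?S \<Longrightarrow> y \<bullet> f y \<le> b \<bullet> f b"
    using continuous_attains_sup[of ?S "\<lambda>x. x \<bullet> f x"] by blast
  define l where "l = b \<bullet> f b"
  have bb: "b \<bullet> b = 1" "b \<in> U"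
    using b(1) by (auto simp: dot_square_norm)
  have upper: "y \<bullet> f y \<le> l * (y \<bullet> y)" if "y \<in> U" for y
  proof (cases "y = 0")
    case False
    have "(y /\<^sub>R norm y) \<bullet> f (y /\<^sub>R norm y) \<le> l"
      unfolding l_def using False that U(1) by (intro b(2)) (simp add: subspace_mul)
    then have "(y \<bullet> f y) / (norm y)\<^sup>2 \<le> l"
      by (simp add: scale power2_eq_square divide_inverse mult_ac)
    then show ?thesis
      using False by (simp add: dot_square_norm field_simps)
  qed (simp add: zero)
  have "(l *\<^sub>R b - f b) \<bullet> y = 0" if y: "y \<in> U" for y
  proof (rule quadratic_nonneg_imp_linear_coeff_zero)
    fix t :: real
    have "b + t *\<^sub>R y \<in> U"
      using bb y U(1) by (simp add: subspace_add subspace_mul)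
    from upper[OF this]
    have "0 \<le> l * ((b + t *\<^sub>R y) \<bullet> (b + t *\<^sub>R y)) - (b + t *\<^sub>R y) \<bullet> f (b + t *\<^sub>R y)"
      by simp
    also have "\<dots> = 2 * t * ((l *\<^sub>R b - f b) \<bullet> y) + t\<^sup>2 * (l * (y \<bullet> y) - y \<bullet> f y)"
      using sa[of b y] bb l_def
      by (simp add: add scale inner_add_left inner_add_right inner_diff_left inner_commute
          power2_eq_square algebra_simps)
    finally show "0 \<le> 2 * t * ((l *\<^sub>R b - f b) \<bullet> y) + t\<^sup>2 * (l * (y \<bullet> y) - y \<bullet> f y)" .
  qed
  moreover have "l *\<^sub>R b - f b \<in> U"
    using bb U by (intro subspace_diff subspace_mul) auto
  ultimately have "f b = l *\<^sub>R b"
    by (metis inner_eq_zero_iff right_minus_eq)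
  with b(1) show ?thesis
    by (intro that[of b]) (auto simp: l_def)
qed

text \<open>
  Spectral theorem, by splitting off one eigenvector: its orthogonal complement within \<open>U\<close> is again invariant.
  The last clause is the expansion of \<open>x\<close> in the basis, which is the form that functional calculus uses.
\<close>

lemma selfadjoint_orthonormal_eigenbasis:
  fixes f :: "'a::euclidean_space \<Rightarrow> 'a"
  assumes lin: "linear f" and sa: "\<And>x y. f x \<bullet> y = x \<bullet> f y"
    and "subspace U" "f ` U \<subseteq> U"
  shows "\<exists>B. B \<subseteq> U \<and> finite B \<and> (\<forall>b\<in>B. \<forall>c\<in>B. b \<bullet> c = (if b = c then 1 else 0)) \<and>
             (\<forall>b\<in>B. f b = (b \<bullet> f b) *\<^sub>R b) \<and> (\<forall>x\<in>U. x = (\<Sum>b\<in>B. (x \<bullet> b) *\<^sub>R b))"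
  using assms(3,4)
proof (induction "dim U" arbitrary: U rule: less_induct)
  case less
  show ?case
  proof (cases "U = {0}")
    case True
    then show ?thesis
      by (intro exI[of _ "{}"]) auto
  next
    case False
    obtain b where b: "b \<in> U" "norm b = 1" and eig: "f b = (b \<bullet> f b) *\<^sub>R b"
      using selfadjoint_eigenvector_exists[OF lin sa less.prems False] by blast
    have bb: "b \<bullet> b = 1"
      using b by (simp add: dot_square_norm)
    let ?V = "{y \<in> U. b \<bullet> y = 0}"
    have V: "subspace ?V"
      using less.prems(1) by (auto simp: subspace_def inner_add_right)
    have "b \<bullet> f y = 0" if "b \<bullet> y = 0" for y
    proof -
      have "b \<bullet> f y = f b \<bullet> y" by (simp add: sa)
      also have "\<dots> = ((b \<bullet> f b) *\<^sub>R b) \<bullet> y" using eig by metis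
      finally show ?thesis using that by simp
    qed
    then have fV: "f ` ?V \<subseteq> ?V"
      using less.prems(2) by auto
    have "dim ?V < dim U"
    proof (rule dim_psubset)
      have "b \<notin> ?V" using bb by simp
      then have "?V \<subset> U" using b by blast
      then show "span ?V \<subset> span U"
        using V less.prems(1) by (simp only: span_eq_iff[THEN iffD2])
    qed
    from less.hyps[OF this V fV] obtain B where B: "B \<subseteq> ?V" "finite B"
      "\<forall>b\<in>B. \<forall>c\<in>B. b \<bullet> c = (if b = c then 1 else 0)" "\<forall>b\<in>B. f b = (b \<bullet> f b) *\<^sub>R b"
      and ex: "\<forall>x\<in>?V. x = (\<Sum>b\<in>B. (x \<bullet> b) *\<^sub>R b)"
      by (elim exE conjE)
    have bB: "b \<bullet> c = 0" "c \<bullet> b = 0" if "c \<in> B" for c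
      using B(1) that inner_commute[of b c] by auto
    have "b \<notin> B"
      using bB(1)[of b] bb by fastforce
    have "x = (\<Sum>c\<in>insert b B. (x \<bullet> c) *\<^sub>R c)" if "x \<in> U" for x
    proof -
      let ?y = "x - (x \<bullet> b) *\<^sub>R b"
      have "?y \<in> ?V"
        using that b less.prems(1) bb inner_commute[of b x]
        by (simp add: inner_diff_right subspace_diff subspace_mul)
      then have "?y = (\<Sum>c\<in>B. (?y \<bullet> c) *\<^sub>R c)"
        using ex by (rule bspec[rotated])
      also have "\<dots> = (\<Sum>c\<in>B. (x \<bullet> c) *\<^sub>R c)"
        using bB by (intro sum.cong) (auto simp: inner_diff_left)
      finally show ?thesis
        using B(2) \<open>b \<notin> B\<close> by (simp add: algebra_simps)
    qed
    moreover have "\<forall>c\<in>insert b B. \<forall>e\<in>insert b B. c \<bullet> e = (if c = e then 1 else 0)"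
      using B(3) bB bb \<open>b \<notin> B\<close> by (metis insert_iff)
    moreover have "\<forall>c\<in>insert b B. f c = (c \<bullet> f c) *\<^sub>R c" "insert b B \<subseteq> U" "finite (insert b B)"
      using B(1,2,4) b eig by (metis insert_iff, blast, blast)
    ultimately show ?thesis
      by blast
  qed
qed

lemma matrix_inner_transpose:
  fixes A :: "real^'m^'k"
  shows "(A *v x) \<bullet> y = x \<bullet> (transpose A *v y)"
  using dot_lmul_matrix[of x "transpose A" y] by (simp add: inner_commute)

lemma symmetric_matrix_inner:
  fixes A :: "real^'m^'m"
  assumes "transpose A = A"
  shows "(A *v x) \<bullet> y = x \<bullet> (A *v y)"
  using matrix_inner_transpose[of A x y] assms by simp

text \<open>
  The root acts on an eigenbasis by the square roots \<open>s b\<close> of the eigenvalues.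
\<close>

lemma psd_sqrt_exists:
  fixes A :: "real^'m^'m"
  assumes "psd A"
  shows "\<exists>R. psd R \<and> R ** R = A"
proof -
  have sym: "transpose A = A" and nn: "\<And>v. 0 \<le> v \<bullet> (A *v v)"
    using assms by (auto simp: psd_def)
  obtain B :: "(real^'m) set" where B: "finite B"
    "\<And>b c. b \<in> B \<Longrightarrow> c \<in> B \<Longrightarrow> b \<bullet> c = (if b = c then 1 else 0)"
    "\<And>b. b \<in> B \<Longrightarrow> A *v b = (b \<bullet> (A *v b)) *\<^sub>R b"
    "\<And>x. x = (\<Sum>b\<in>B. (x \<bullet> b) *\<^sub>R b)"
    using selfadjoint_orthonormal_eigenbasis[OF matrix_vector_mul_linear symmetric_matrix_inner[OF sym],
        of UNIV] by auto
  define s where "s = (\<lambda>b. sqrt (b \<bullet> (A *v b)))"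
  define g where "g x = (\<Sum>b\<in>B. (s b * (x \<bullet> b)) *\<^sub>R b)" for x
  have lin: "linear g"
    unfolding g_def
    by (rule linearI) (simp_all add: inner_add_left algebra_simps sum.distrib scaleR_sum_right)
  define R where "R = matrix g"
  have R: "R *v x = g x" for x
    unfolding R_def using lin by (simp add: matrix_works)
  have gsa: "g x \<bullet> y = x \<bullet> g y" for x y
    unfolding g_def by (simp add: inner_sum_left inner_sum_right inner_commute algebra_simps)
  have "transpose R = R"
  proof (subst matrix_eq, rule allI)
    fix x
    have "(transpose R *v x) \<bullet> y = (R *v x) \<bullet> y" for y
      unfolding matrix_inner_transpose transpose_transpose R by (simp add: gsa)
    then show "transpose R *v x = R *v x"
      by (metis vector_eq_rdot)
  qed
  moreover have "0 \<le> v \<bullet> (R *v v)" for v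
  proof -
    have "v \<bullet> (R *v v) = (\<Sum>b\<in>B. s b * (v \<bullet> b)\<^sup>2)"
      unfolding R g_def by (simp add: inner_sum_right power2_eq_square mult.assoc)
    then show ?thesis
      using nn by (auto simp: s_def intro!: sum_nonneg)
  qed
  moreover have "R ** R = A"
  proof (subst matrix_eq, rule allI)
    fix x
    have gb: "g x \<bullet> b = s b * (x \<bullet> b)" if "b \<in> B" for b
    proof -
      have "g x \<bullet> b = (\<Sum>c\<in>B. s c * (x \<bullet> c) * (c \<bullet> b))"
        by (simp add: g_def inner_sum_left)
      also have "\<dots> = (\<Sum>c\<in>B. if c = b then s b * (x \<bullet> b) else 0)"
        using B(2) that by (intro sum.cong) auto
      finally show ?thesis using B(1) that by simp
    qed
    have "(R ** R) *v x = g (g x)"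
      by (simp add: R flip: matrix_vector_mul_assoc)
    also have "\<dots> = (\<Sum>b\<in>B. (s b * (s b * (x \<bullet> b))) *\<^sub>R b)"
      unfolding g_def[of "g x"] by (intro sum.cong) (simp_all add: gb)
    also have "\<dots> = (\<Sum>b\<in>B. (x \<bullet> b) *\<^sub>R (A *v b))"
    proof (intro sum.cong refl)
      fix b assume "b \<in> B"
      have "s b * (s b * (x \<bullet> b)) = (x \<bullet> b) * (b \<bullet> (A *v b))"
        using nn[of b] by (simp add: s_def flip: mult.assoc)
      then show "(s b * (s b * (x \<bullet> b))) *\<^sub>R b = (x \<bullet> b) *\<^sub>R (A *v b)"
        by (subst B(3)[OF \<open>b \<in> B\<close>]) simp
    qed
    also have "\<dots> = A *v (\<Sum>b\<in>B. (x \<bullet> b) *\<^sub>R b)"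
      by (simp add: linear_sum[OF matrix_vector_mul_linear] matrix_vector_mult_scaleR)
    finally show "(R ** R) *v x = A *v x"
      using B(4)[of x] by simp
  qed
  ultimately show ?thesis
    by (auto simp: psd_def)
qed

lemma psd_sqrt_works:
  fixes A :: "real^'m^'m"
  assumes "psd A"
  shows "transpose (psd_sqrt A) = psd_sqrt A" "psd_sqrt A ** psd_sqrt A = A"
  using someI_ex[OF psd_sqrt_exists[OF assms]] by (auto simp: psd_sqrt_def psd_def)

section \<open>Linear images and simplices\<close>

definition scales_measure :: "real \<Rightarrow> (real^'n \<Rightarrow> real^'n) \<Rightarrow> bool" where
  "scales_measure c f \<longleftrightarrow>
     (\<forall>S\<in>lmeasurable. f ` S \<in> lmeasurable \<and> measure lebesgue (f ` S) = c * measure lebesgue S)"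

lemma scales_measureI:
  assumes "linear f" "\<And>a b. cbox a b \<noteq> {} \<Longrightarrow> measure lebesgue (f ` cbox a b) = c * measure lebesgue (cbox a b)"
  shows "scales_measure c f"
proof -
  have "measure lebesgue (f ` cbox a b) = c * measure lebesgue (cbox a b)" for a b
    using assms(2)[of a b] by (cases "cbox a b = {}") auto
  then show ?thesis
    using measure_linear_sufficient[OF assms(1)] by (fastforce simp: scales_measure_def)
qed

lemma scales_measure_transposition:
  fixes m n :: "'n::finite"
  shows "scales_measure 1 (\<lambda>x::real^'n. \<chi> i. x $ Transposition.transpose m n i)"
proof (rule scales_measureI)
  let ?p = "Transposition.transpose m n"
  let ?h = "\<lambda>x::real^'n. \<chi> i. x $ ?p i"
  show "linear ?h"
    by (rule linearI) (simp_all add: vec_eq_iff)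
  fix a b :: "real^'n" assume ne: "cbox a b \<noteq> {}"
  have hh: "?h (?h x) = x" for x
    by (simp add: vec_eq_iff)
  have "?h ` cbox a b = cbox (?h a) (?h b)"
  proof
    show "?h ` cbox a b \<subseteq> cbox (?h a) (?h b)"
      by (auto simp: mem_box_cart)
    show "cbox (?h a) (?h b) \<subseteq> ?h ` cbox a b"
    proof
      fix x assume "x \<in> cbox (?h a) (?h b)"
      then have "a $ ?p i \<le> x $ i \<and> x $ i \<le> b $ ?p i" for i
        by (simp add: mem_box_cart)
      from this[of "?p _"] have "?h x \<in> cbox a b"
        by (simp add: mem_box_cart)
      then show "x \<in> ?h ` cbox a b"
        using hh[of x] by (metis image_eqI)
    qed
  qed
  moreover from this have "cbox (?h a) (?h b) \<noteq> {}"
    using ne by (metis image_is_empty)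
  moreover have "(\<Prod>i\<in>UNIV. b $ ?p i - a $ ?p i) = (\<Prod>i\<in>UNIV. b $ i - a $ i)"
    by (rule prod.reindex_bij_betw[OF bij_transpose])
  ultimately show "measure lebesgue (?h ` cbox a b) = 1 * measure lebesgue (cbox a b)"
    using ne by (simp add: content_cbox_cart)
qed

lemma scales_measure_shear:
  fixes m n :: "'n::finite"
  assumes "m \<noteq> n"
  shows "scales_measure 1 (\<lambda>x::real^'n. \<chi> i. if i = m then x $ m + x $ n else x $ i)"
proof (rule scales_measureI)
  let ?h = "\<lambda>x::real^'n. \<chi> i. if i = m then x $ m + x $ n else x $ i"
  show lin: "linear ?h"
    by (rule linearI) (simp_all add: vec_eq_iff algebra_simps)
  fix a b :: "real^'n" assume ne: "cbox a b \<noteq> {}"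
  \<comment> \<open>the box is moved so that its \<open>n\<close>-th coordinates start at 0\<close>
  define v where "v = axis n (- (a $ n))"
  have box: "(+) v ` cbox a b = cbox (v + a) (v + b)"
    by (rule cbox_translation[symmetric])
  have "measure lebesgue (?h ` cbox a b) = measure lebesgue ((+) (?h v) ` ?h ` cbox a b)"
    by (rule measure_translation[symmetric])
  also have "(+) (?h v) ` ?h ` cbox a b = ?h ` (+) v ` cbox a b"
    using linear_add[OF lin, of v] by (simp add: image_image)
  also have "measure lebesgue \<dots> = measure lebesgue (cbox (v + a) (v + b))"
    unfolding box using ne box assms
    by (intro measure_shear_interval) (auto simp: v_def)
  also have "\<dots> = measure lebesgue (cbox a b)"
    using box measure_translation[of v "cbox a b"] by simp
  finally show "measure lebesgue (?h ` cbox a b) = 1 * measure lebesgue (cbox a b)"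
    by simp
qed

text \<open>
  Both sides are multiplicative under composition, so it suffices to look at the elementary maps: singular maps
  have null images, stretches multiply volumes by the product of the factors, and coordinate swaps and shears
  keep them.
\<close>

lemma scales_measure_det:
  fixes f :: "real^'n \<Rightarrow> real^'n"
  assumes "linear f"
  shows "scales_measure \<bar>det (matrix f)\<bar> f"
proof (rule induct_linear_elementary[OF assms])
  fix f g :: "real^'n \<Rightarrow> real^'n"
  assume "linear f" "linear g" "scales_measure \<bar>det (matrix f)\<bar> f" "scales_measure \<bar>det (matrix g)\<bar> g"
  then show "scales_measure \<bar>det (matrix (f \<circ> g))\<bar> (f \<circ> g)"
    by (simp add: scales_measure_def matrix_compose det_mul abs_mult mult.assoc flip: image_image)
next
  fix f :: "real^'n \<Rightarrow> real^'n" and i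
  assume f: "linear f" and "\<And>x. f x $ i = 0"
  then have "\<not> surj f"
    by (metis one_neq_zero surjD vec_component)
  then have "\<not> inj f"
    using linear_injective_imp_surjective[OF f] by blast
  moreover from this have "det (matrix f) = 0"
    using det_nz_iff_inj[OF f] by blast
  ultimately show "scales_measure \<bar>det (matrix f)\<bar> f"
    using negligible_linear_singular_image[OF f]
    by (auto simp: scales_measure_def negligible_iff_measure)
next
  fix c :: "'n \<Rightarrow> real"
  show "scales_measure \<bar>det (matrix (\<lambda>x::real^'n. \<chi> i. c i * x $ i))\<bar> (\<lambda>x. \<chi> i. c i * x $ i)"
    by (simp add: scales_measure_def measurable_stretch measure_stretch matrix_def axis_def det_diagonal)
next
  fix m n :: 'n
  let ?h = "\<lambda>x::real^'n. \<chi> i. x $ Transposition.transpose m n i"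
  have "matrix ?h = (\<chi> i. mat 1 $ Transposition.transpose m n i)"
    by (simp add: vec_eq_iff matrix_def axis_def mat_def)
  then have "\<bar>det (matrix ?h)\<bar> = 1"
    by (cases "m = n") (simp_all add: det_permute_rows permutes_swap_id sign_swap_id abs_mult)
  then show "scales_measure \<bar>det (matrix ?h)\<bar> ?h"
    using scales_measure_transposition by simp
next
  fix m n :: 'n
  assume mn: "m \<noteq> n"
  let ?h = "\<lambda>x::real^'n. \<chi> i. if i = m then x $ m + x $ n else x $ i"
  have "matrix ?h = (\<chi> k. if k = m then row m (mat 1) + 1 *s row n (mat 1) else row k (mat 1))"
    by (auto simp: vec_eq_iff matrix_def axis_def mat_def row_def)
  then have "det (matrix ?h) = 1"
    using det_row_operation[OF mn, of "mat 1 :: real^'n^'n" 1] by simp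
  then show "scales_measure \<bar>det (matrix ?h)\<bar> ?h"
    using scales_measure_shear[OF mn] by simp
qed

text \<open>
  The image of the unit ball is contained in the ball of radius \<open>c\<close>; compare volumes.
\<close>

lemma abs_det_le_power:
  fixes S :: "real^'n^'n"
  assumes "\<And>x. norm (S *v x) \<le> c * norm x"
  shows "\<bar>det S\<bar> \<le> c ^ CARD('n)"
proof -
  have "0 \<le> c * norm (axis undefined 1 :: real^'n)"
    using assms norm_ge_zero order_trans by blast
  then have c: "0 \<le> c"
    by (simp add: norm_axis_1)
  let ?B = "cball 0 1 :: (real^'n) set"
  have S: "(*v) S ` ?B \<in> lmeasurable" "measure lebesgue ((*v) S ` ?B) = \<bar>det S\<bar> * measure lebesgue ?B"
    using scales_measure_det[OF matrix_vector_mul_linear, of S]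
    by (auto simp: scales_measure_def matrix_of_matrix_vector_mul)
  have "norm (S *v x) \<le> c" if "norm x \<le> 1" for x
    using assms[of x] mult_left_mono[OF that c] by linarith
  then have "(*v) S ` ?B \<subseteq> cball 0 c"
    by auto
  then have "\<bar>det S\<bar> * measure lborel ?B \<le> measure lborel (cball 0 c :: (real^'n) set)"
    using measure_mono_fmeasurable[OF _ fmeasurableD[OF S(1)], of "cball 0 c"] S(2) by simp
  then show ?thesis
    using c by (simp add: content_cball)
qed

lemma convex_hull_affine_image:
  assumes "linear f"
  shows "(\<lambda>x. a + f x) ` (convex hull X) = convex hull ((\<lambda>x. a + f x) ` X)"
  using convex_hull_translation[of a "f ` X"] convex_hull_linear_image[OF assms, of X]
  by (metis image_image)

lemma edge_matrix_mult_axis: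
  "edge_matrix w *v axis j 1 = w (Some j) - w None"
  by (simp add: edge_matrix_def matrix_vector_mult_basis column_def vec_eq_iff)

text \<open>
  The simplex is the image of the standard simplex, of volume \<open>1 / n!\<close>, under the affine map with linear part
  \<open>edge_matrix w\<close>.
\<close>

lemma simplex_volume_eq_det:
  fixes w :: "'n::finite option \<Rightarrow> real^'n"
  shows "simplex_volume w = \<bar>det (edge_matrix w)\<bar> / fact CARD('n)"
proof -
  let ?E = "edge_matrix w"
  let ?std = "convex hull (insert 0 Basis) :: (real^'n) set"
  have rng: "range w = (\<lambda>x. w None + ?E *v x) ` insert 0 Basis"
    by (simp add: Basis_vec_def edge_matrix_mult_axis UNIV_option_conv image_image image_UN full_SetCompr_eq
        UNION_singleton_eq_range)
  then have img: "flat_simplex w = (+) (w None) ` (*v) ?E ` ?std"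
    unfolding flat_simplex_def rng convex_hull_affine_image[OF matrix_vector_mul_linear, symmetric]
    by (simp add: image_image)
  have "compact ?std"
    by (intro finite_imp_compact_convex_hull) auto
  then have std: "?std \<in> lmeasurable"
    by (rule lmeasurable_compact)
  have "compact (flat_simplex w)"
    unfolding flat_simplex_def by (intro finite_imp_compact_convex_hull) auto
  then have "simplex_volume w = measure lebesgue (flat_simplex w)"
    by (simp add: simplex_volume_def compact_imp_closed)
  also have "\<dots> = measure lebesgue ((*v) ?E ` ?std)"
    unfolding img by (rule measure_translation)
  also have "\<dots> = \<bar>det ?E\<bar> * measure lebesgue ?std"
    using scales_measure_det[OF matrix_vector_mul_linear, of ?E] std
    by (simp add: scales_measure_def matrix_of_matrix_vector_mul)
  also have "measure lebesgue ?std = 1 / fact CARD('n)"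
    using content_std_simplex[where 'a="real^'n"] \<open>compact ?std\<close> by (simp add: compact_imp_closed)
  finally show ?thesis by simp
qed

section \<open>The area of a flat simplex\<close>

text \<open>
  The edges of a degenerate simplex span too small a space to carry a chart, so their span is first enlarged to
  a subspace of the right dimension.
\<close>

lemma isometric_chart_exists:
  fixes v :: "'n::finite option \<Rightarrow> real^'d"
  assumes "CARD('n) \<le> CARD('d)"
  shows "\<exists>f. isometric_chart v f"
proof -
  define U where "U = span (range (\<lambda>j. v (Some j) - v None))"
  have U: "subspace U" and dimU: "dim U \<le> CARD('n)"
    unfolding U_def using dim_le_card'[of "range (\<lambda>j. v (Some j) - v None)"]
      card_image_le[of UNIV "\<lambda>j. v (Some j) - v None"] by auto
  \<comment> \<open>a subspace of dimension \<open>CARD('n)\<close> containing \<open>U\<close>, as the complement of one inside the complement of \<open>U\<close>\<close>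
  define Uo where "Uo = {y \<in> UNIV. \<forall>x\<in>U. orthogonal x y}"
  have "dim Uo + dim U = CARD('d)"
    using dim_subspace_orthogonal_to_vectors[OF U subspace_UNIV] by (simp add: Uo_def)
  then have "CARD('d) - CARD('n) \<le> dim Uo"
    using dimU by linarith
  moreover have "subspace Uo"
    by (auto simp: Uo_def subspace_def orthogonal_clauses)
  ultimately obtain T where T: "subspace T" "T \<subseteq> Uo" "dim T = CARD('d) - CARD('n)"
    using choose_subspace_of_subspace[of "CARD('d) - CARD('n)" Uo] by (metis span_eq_iff)
  define V where "V = {y \<in> UNIV. \<forall>x\<in>T. orthogonal x y}"
  have "dim V + dim T = CARD('d)"
    using dim_subspace_orthogonal_to_vectors[OF T(1) subspace_UNIV] by (simp add: V_def)
  then have "dim V = dim (UNIV :: (real^'n) set)"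
    using T(3) assms by simp
  moreover have "subspace V"
    by (auto simp: V_def subspace_def orthogonal_clauses)
  ultimately obtain f :: "real^'n \<Rightarrow> real^'d" where f: "linear f" "range f = V" "\<And>x. norm (f x) = norm x"
    using isometries_subspaces[of "UNIV :: (real^'n) set" V] by (metis UNIV_I subspace_UNIV)
  have "orthogonal t u" if "u \<in> U" "t \<in> T" for t u
    using T(2) that orthogonal_commute[of u t] by (auto simp: Uo_def)
  then have "U \<subseteq> V"
    by (auto simp: V_def)
  have "v i \<in> range (\<lambda>y. v None + f y)" for i
  proof (cases i)
    case None
    then show ?thesis
      using linear_0[OF f(1)] by (intro image_eqI[of _ _ 0]) auto
  next
    case (Some j)
    have "v (Some j) - v None \<in> range f"
      using \<open>U \<subseteq> V\<close> unfolding f(2) U_def by (auto intro: span_base)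
    then obtain y where "v (Some j) - v None = f y"
      by blast
    then have "v i = v None + f y"
      using Some by (simp add: algebra_simps)
    then show ?thesis
      by blast
  qed
  moreover have "dist (v None + f y) (v None + f z) = dist y z" for y z
    using f(3)[of "y - z"] linear_diff[OF f(1)] by (simp add: dist_norm)
  ultimately show ?thesis
    by (intro exI[of _ "\<lambda>y. v None + f y"]) (auto simp: isometric_chart_def)
qed

text \<open>
  Polarization turns distances into inner products; then the defects of additivity and homogeneity have norm
  zero, as one sees by expanding.
\<close>

lemma distance_preserving_imp_linear:
  fixes g :: "'a::real_inner \<Rightarrow> 'b::real_inner"
  assumes "g 0 = 0" and dist: "\<And>y z. dist (g y) (g z) = dist y z"
  shows "linear g" "g x \<bullet> g y = x \<bullet> y"
proof -
  have norm: "norm (g x) = norm x" for x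
    using dist[of x 0] assms(1) by simp
  have inner: "g x \<bullet> g y = x \<bullet> y" for x y
    using dist[of x y] norm[of x] norm[of y] by (simp add: dot_norm_neg dist_norm)
  then show "g x \<bullet> g y = x \<bullet> y" .
  show "linear g"
  proof (rule linearI)
    fix x y
    have "(g (x + y) - g x - g y) \<bullet> (g (x + y) - g x - g y) = 0"
      by (simp add: inner_diff_left inner_diff_right inner inner_add_left inner_add_right)
    then show "g (x + y) = g x + g y"
      unfolding inner_eq_zero_iff by (simp add: algebra_simps)
  next
    fix r x
    have "(g (r *\<^sub>R x) - r *\<^sub>R g x) \<bullet> (g (r *\<^sub>R x) - r *\<^sub>R g x) = 0"
      by (simp add: inner_diff_left inner_diff_right inner)
    then show "g (r *\<^sub>R x) = r *\<^sub>R g x"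
      by simp
  qed
qed

text \<open>
  A chart turns \<open>v\<close> into a full-dimensional simplex \<open>w\<close>, and its linear part \<open>L\<close> satisfies \<open>L\<^sup>T L = 1\<close>, so \<open>v\<close>
  and \<open>w\<close> have the same Gram matrix, whose determinant is \<open>(det (edge_matrix w))\<^sup>2\<close>. The formula
  covers degenerate simplices; therefore it also shows that the area is continuous in the vertices.
\<close>

lemma simplex_area_eq_gram_det:
  fixes v :: "'n::finite option \<Rightarrow> real^'d"
  assumes "CARD('n) \<le> CARD('d)"
  shows "simplex_area v = sqrt (det (transpose (edge_matrix v) ** edge_matrix v)) / fact CARD('n)"
proof -
  define f where "f = (SOME f. isometric_chart v f)"
  have "isometric_chart v f"
    unfolding f_def using isometric_chart_exists[OF assms] by (rule someI_ex)
  then have dist: "dist (f y) (f z) = dist y z" and rng: "range v \<subseteq> range f" for y z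
    by (auto simp: isometric_chart_def)
  define g where "g y = f y - f 0" for y
  have "g 0 = 0" and distg: "dist (g y) (g z) = dist y z" for y z
    using dist[of y z] by (auto simp: g_def dist_norm)
  note g = distance_preserving_imp_linear[OF this]
  define L where "L = matrix g"
  have Lg: "L *v y = g y" for y
    unfolding L_def using g(1) by (simp add: matrix_works)
  have f_affine: "f y = f 0 + L *v y" for y
    by (simp add: Lg g_def)
  have LL: "transpose L ** L = mat 1"
  proof (subst matrix_eq, rule allI)
    fix x
    have "((transpose L ** L) *v x) \<bullet> y = (mat 1 *v x) \<bullet> y" for y
      using g(2)[of x y] by (simp add: matrix_inner_transpose Lg flip: matrix_vector_mul_assoc del: transpose_matrix_vector)
    then show "(transpose L ** L) *v x = mat 1 *v x"
      by (metis vector_eq_rdot)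
  qed
  have "\<forall>i. \<exists>y. v i = f y"
    using rng by blast
  then obtain w where w: "\<And>i. v i = f (w i)"
    by metis
  have "edge_matrix v = L ** edge_matrix w"
  proof -
    have "edge_matrix v *v axis j 1 = (L ** edge_matrix w) *v axis j 1" for j
      by (simp add: edge_matrix_mult_axis w f_affine[of "w _"] matrix_vector_mult_diff_distrib
          flip: matrix_vector_mul_assoc)
    then show ?thesis
      by (simp add: vec_eq_iff matrix_vector_mult_basis column_def)
  qed
  then have "transpose (edge_matrix v) ** edge_matrix v
      = transpose (edge_matrix w) ** (transpose L ** L) ** edge_matrix w"
    by (simp add: matrix_transpose_mul matrix_mul_assoc)
  then have gram: "sqrt (det (transpose (edge_matrix v) ** edge_matrix v)) = \<bar>det (edge_matrix w)\<bar>"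
    by (simp add: LL det_mul)
  have "inj f"
    using dist by (metis dist_eq_0_iff injI)
  have "flat_simplex v = f ` flat_simplex w"
  proof -
    have f: "f ` X = (\<lambda>y. f 0 + L *v y) ` X" for X
      by (intro image_cong refl f_affine)
    have "range v = f ` range w"
      using w by auto
    then show ?thesis
      unfolding flat_simplex_def f
      by (simp only: convex_hull_affine_image[OF matrix_vector_mul_linear])
  qed
  then have pre: "f -` flat_simplex v = flat_simplex w"
    using \<open>inj f\<close> by (simp add: inj_vimage_image_eq)
  have "continuous_on UNIV f"
    by (rule continuous_onI) (use dist in auto)
  then have "f \<in> borel_measurable borel"
    by (rule borel_measurable_continuous_onI)
  moreover have "compact (flat_simplex v)"
    unfolding flat_simplex_def by (intro finite_imp_compact_convex_hull) auto
  ultimately have "simplex_area v = simplex_volume w"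
    unfolding simplex_area_def area_measure_def f_def[symmetric] simplex_volume_def
    by (subst measure_distr) (auto simp: pre compact_imp_closed)
  then show ?thesis
    by (simp add: simplex_volume_eq_det gram)
qed

section \<open>Averages of the metric tensor\<close>

lemma quadratic_form_polarization:
  fixes A :: "real^'m^'m"
  assumes "transpose A = A"
  shows "4 * (x \<bullet> (A *v y)) = (x + y) \<bullet> (A *v (x + y)) - (x - y) \<bullet> (A *v (x - y))"
proof -
  have "y \<bullet> (A *v x) = x \<bullet> (A *v y)"
    using symmetric_matrix_inner[OF assms, of x y] by (simp add: inner_commute)
  then show ?thesis
    by (simp add: matrix_vector_right_distrib matrix_vector_mult_diff_distrib
        inner_add_left inner_add_right inner_diff_left inner_diff_right)
qed

lemma loewner_le_mat_iff:
  fixes A :: "real^'m^'m"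
  assumes "transpose A = A"
  shows "loewner_le (mat c) A \<longleftrightarrow> (\<forall>x. c * (x \<bullet> x) \<le> x \<bullet> (A *v x))"
    and "loewner_le A (mat c) \<longleftrightarrow> (\<forall>x. x \<bullet> (A *v x) \<le> c * (x \<bullet> x))"
proof -
  have c: "mat c *v x = c *\<^sub>R x" for x :: "real^'m"
    by (simp add: vec_eq_iff matrix_vector_mult_def mat_def if_distrib if_distribR cong: if_cong)
  have tr: "transpose (A - mat c) = A - mat c" "transpose (mat c - A) = mat c - A"
    using assms by (simp_all add: transpose_def vec_eq_iff mat_def)
  show "loewner_le (mat c) A \<longleftrightarrow> (\<forall>x. c * (x \<bullet> x) \<le> x \<bullet> (A *v x))"
    "loewner_le A (mat c) \<longleftrightarrow> (\<forall>x. x \<bullet> (A *v x) \<le> c * (x \<bullet> x))"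
    by (simp_all add: loewner_le_def psd_def tr matrix_vector_mult_diff_rdistrib c inner_diff_right)
qed

text \<open>
  This crude bound serves to integrate the metric tensor over an element. The entries of \<open>A\<close> are values of the
  bilinear form, which polarization bounds by those of the quadratic form.
\<close>

lemma norm_le_if_quadratic_form_bounded:
  fixes A :: "real^'m^'m"
  assumes sym: "transpose A = A" and "\<And>x. 0 \<le> x \<bullet> (A *v x)" "\<And>x. x \<bullet> (A *v x) \<le> c * (x \<bullet> x)"
  shows "norm A \<le> real CARD('m) * (real CARD('m) * c)"
proof -
  have "\<bar>A $ i $ j\<bar> \<le> c" for i j
  proof -
    let ?x = "axis i 1 :: real^'m" and ?y = "axis j 1 :: real^'m"
    have "A $ i $ j = ?x \<bullet> (A *v ?y)"
      by (simp add: matrix_vector_mult_basis column_def inner_axis')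
    moreover have "\<bar>4 * (?x \<bullet> (A *v ?y))\<bar> \<le> 4 * c"
    proof -
      have "(?x + ?y) \<bullet> (?x + ?y) + (?x - ?y) \<bullet> (?x - ?y) = 4"
        by (simp add: inner_add_left inner_add_right inner_diff_left inner_diff_right inner_axis_axis)
      then have "c * ((?x + ?y) \<bullet> (?x + ?y)) + c * ((?x - ?y) \<bullet> (?x - ?y)) = 4 * c"
        by (metis distrib_left mult.commute)
      then show ?thesis
        unfolding quadratic_form_polarization[OF sym]
        using assms(2,3)[of "?x + ?y"] assms(2,3)[of "?x - ?y"] by linarith
    qed
    ultimately show ?thesis by simp
  qed
  then have "norm (A $ i) \<le> real CARD('m) * c" for i
    using norm_le_l1_cart[of "A $ i"] sum_bounded_above[of UNIV "\<lambda>j. \<bar>A $ i $ j\<bar>" c] by fastforce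
  then have "(\<Sum>i\<in>UNIV. norm (A $ i)) \<le> real CARD('m) * (real CARD('m) * c)"
    using sum_bounded_above[of UNIV "\<lambda>i. norm (A $ i)"] by simp
  moreover have "norm A \<le> (\<Sum>i\<in>UNIV. norm (A $ i))"
    by (simp add: norm_vec_def L2_set_le_sum)
  ultimately show ?thesis by simp
qed

text \<open>
  Transposition and \<open>B \<mapsto> x \<bullet> (B *v x)\<close> are linear in the matrix, so they commute with the integral, and
  the pointwise bounds can be averaged. Positive area makes the mean a genuine one, over a set of finite
  positive measure.
\<close>

lemma average_metric_bounds:
  fixes M :: "real^'d \<Rightarrow> real^'d^'d" and v :: "'n::finite option \<Rightarrow> real^'d"
  assumes meas: "M \<in> borel_measurable borel" and area: "0 < simplex_area v"
    and sym: "\<And>y. y \<in> flat_simplex v \<Longrightarrow> transpose (M y) = M y"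
    and lo: "\<And>x y. y \<in> flat_simplex v \<Longrightarrow> m_lo * (x \<bullet> x) \<le> x \<bullet> (M y *v x)"
    and up: "\<And>x y. y \<in> flat_simplex v \<Longrightarrow> x \<bullet> (M y *v x) \<le> m_up * (x \<bullet> x)"
    and m_lo: "0 \<le> m_lo"
  shows "transpose (average_metric M v) = average_metric M v"
    and "m_lo * (x \<bullet> x) \<le> x \<bullet> (average_metric M v *v x)"
    and "x \<bullet> (average_metric M v *v x) \<le> m_up * (x \<bullet> x)"
proof -
  let ?\<mu> = "area_measure v" and ?K = "flat_simplex v"
  let ?A = "measure ?\<mu> ?K" and ?I = "LINT y:?K|?\<mu>. M y"
  have area': "0 < ?A"
    using area by (simp add: simplex_area_def)
  have sets[simp]: "sets ?\<mu> = sets borel"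
    by (simp add: area_measure_def)
  have "compact ?K"
    unfolding flat_simplex_def by (intro finite_imp_compact_convex_hull) auto
  then have K[measurable]: "?K \<in> sets ?\<mu>"
    by (simp add: compact_imp_closed)
  have fin: "emeasure ?\<mu> ?K < \<infinity>"
    using area' by (cases "emeasure ?\<mu> ?K") (simp_all add: measure_def)
  have int: "set_integrable ?\<mu> ?K M"
    unfolding set_integrable_def
  proof (rule integrableI_bounded_set_indicator[OF K _ fin])
    show "M \<in> borel_measurable ?\<mu>"
      using meas by (simp cong: measurable_cong_sets)
    show "AE y in ?\<mu>. y \<in> ?K \<longrightarrow> norm (M y) \<le> real CARD('d) * (real CARD('d) * m_up)"
    proof (intro always_eventually allI impI)
      fix y assume y: "y \<in> ?K"
      have "0 \<le> x \<bullet> (M y *v x)" for x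
        using lo[OF y, of x] m_lo by (meson inner_ge_zero mult_nonneg_nonneg order_trans)
      then show "norm (M y) \<le> real CARD('d) * (real CARD('d) * m_up)"
        using norm_le_if_quadratic_form_bounded[OF sym[OF y]] up[OF y] by blast
    qed
  qed
  have const: "set_integrable ?\<mu> ?K (\<lambda>_. c :: real)" "(LINT y:?K|?\<mu>. c) = ?A * c" for c :: real
    using fin K by (auto simp: set_integrable_def set_lebesgue_integral_def)
  have T: "bounded_linear (transpose :: real^'d^'d \<Rightarrow> _)"
    by (intro linear_conv_bounded_linear[THEN iffD1] linearI) (simp_all add: transpose_def vec_eq_iff)
  have "transpose ?I = (LINT y|?\<mu>. transpose (indicator ?K y *\<^sub>R M y))"
    unfolding set_lebesgue_integral_def
    using int by (intro integral_bounded_linear[OF T, symmetric]) (simp add: set_integrable_def)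
  also have "\<dots> = ?I"
    unfolding set_lebesgue_integral_def
    by (intro Bochner_Integration.integral_cong refl) (auto simp: transpose_scalar sym indicator_def)
  finally show "transpose (average_metric M v) = average_metric M v"
    by (simp add: average_metric_def transpose_scalar)
  have Q: "bounded_linear (\<lambda>B::real^'d^'d. x \<bullet> (B *v x))"
    by (intro linear_conv_bounded_linear[THEN iffD1] linearI)
      (simp_all add: matrix_vector_mult_add_rdistrib inner_add_right scaleR_matrix_vector_assoc[symmetric])
  have "x \<bullet> (?I *v x) = (LINT y|?\<mu>. x \<bullet> ((indicator ?K y *\<^sub>R M y) *v x))"
    unfolding set_lebesgue_integral_def
    using int by (intro integral_bounded_linear[OF Q, symmetric]) (simp add: set_integrable_def)
  also have "\<dots> = (LINT y:?K|?\<mu>. x \<bullet> (M y *v x))"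
    unfolding set_lebesgue_integral_def
    by (simp add: scaleR_matrix_vector_assoc[symmetric])
  finally have I: "x \<bullet> (?I *v x) = (LINT y:?K|?\<mu>. x \<bullet> (M y *v x))" .
  have intx: "set_integrable ?\<mu> ?K (\<lambda>y. x \<bullet> (M y *v x))"
    using integrable_bounded_linear[OF Q int[unfolded set_integrable_def]]
    by (simp add: set_integrable_def scaleR_matrix_vector_assoc[symmetric])
  have avg: "x \<bullet> (average_metric M v *v x) = (x \<bullet> (?I *v x)) / ?A"
    by (simp add: average_metric_def simplex_area_def scaleR_matrix_vector_assoc[symmetric])
  have "?A * (m_lo * (x \<bullet> x)) \<le> x \<bullet> (?I *v x)"
    unfolding I const(2)[symmetric] by (rule set_integral_mono[OF const(1) intx lo])
  then show "m_lo * (x \<bullet> x) \<le> x \<bullet> (average_metric M v *v x)"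
    using area' by (simp add: avg field_simps)
  have "x \<bullet> (?I *v x) \<le> ?A * (m_up * (x \<bullet> x))"
    unfolding I const(2)[symmetric] by (rule set_integral_mono[OF intx const(1) up])
  then show "x \<bullet> (average_metric M v *v x) \<le> m_up * (x \<bullet> x)"
    using area' by (simp add: avg field_simps)
qed

section \<open>Positive definite matrices\<close>

lemma spd_invertible:
  fixes A :: "real^'m^'m"
  assumes "spd A"
  shows "invertible A"
proof -
  have "x = 0" if "A *v x = 0" for x
    using assms that by (metis inner_zero_right less_irrefl spd_def)
  then show ?thesis
    by (simp add: invertible_left_inverse matrix_left_invertible_ker)
qed

lemma matrix_inv_inverse:
  fixes A :: "real^'m^'m"
  assumes "invertible A"
  shows "A ** matrix_inv A = mat 1" "matrix_inv A ** A = mat 1"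
proof -
  have "A ** matrix_inv A = mat 1 \<and> matrix_inv A ** A = mat 1"
    using assms unfolding matrix_inv_def invertible_def by (rule someI_ex)
  then show "A ** matrix_inv A = mat 1" "matrix_inv A ** A = mat 1"
    by auto
qed

lemma matrix_inv_unique_left:
  fixes A B :: "real^'m^'m"
  assumes "B ** A = mat 1"
  shows "matrix_inv A = B"
proof -
  have "invertible A"
    using assms invertible_left_inverse by blast
  then have "B ** (A ** matrix_inv A) = B"
    by (simp add: matrix_inv_inverse)
  then show ?thesis
    by (simp add: matrix_mul_assoc assms)
qed

lemma det_matrix_inv:
  fixes A :: "real^'m^'m"
  assumes "invertible A"
  shows "det (matrix_inv A) = 1 / det A"
proof -
  have "det A * det (matrix_inv A) = 1"
    using matrix_inv_inverse(1)[OF assms] by (simp flip: det_mul)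
  then show ?thesis
    by (metis div_by_0 mult_zero_left nonzero_mult_div_cancel_left zero_neq_one)
qed

lemma spd_matrix_inv:
  fixes A :: "real^'m^'m"
  assumes "spd A"
  shows "spd (matrix_inv A)"
proof -
  have inv: "invertible A" and sym: "transpose A = A"
    using assms spd_invertible by (auto simp: spd_def)
  have "transpose (matrix_inv A) ** A = transpose (A ** matrix_inv A)"
    by (simp add: matrix_transpose_mul sym)
  also have "\<dots> = mat 1"
    by (simp add: matrix_inv_inverse inv)
  finally have "transpose (matrix_inv A) = matrix_inv A"
    by (rule matrix_inv_unique_left[symmetric])
  moreover have "0 < x \<bullet> (matrix_inv A *v x)" if "x \<noteq> 0" for x
  proof -
    let ?y = "matrix_inv A *v x"
    have x: "A *v ?y = x"
      by (simp add: matrix_vector_mul_assoc matrix_inv_inverse inv)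
    then have "?y \<noteq> 0"
      using that by force
    then have "0 < ?y \<bullet> (A *v ?y)"
      using assms by (simp add: spd_def)
    then show ?thesis
      unfolding x by (simp add: inner_commute)
  qed
  ultimately show ?thesis
    by (simp add: spd_def)
qed

lemma spd_sqrt:
  fixes A :: "real^'m^'m"
  assumes "spd A"
  obtains S where "transpose S = S" "S ** S = A" "invertible S"
    "\<And>x. (S *v x) \<bullet> (S *v x) = x \<bullet> (A *v x)"
proof -
  have "psd A"
    unfolding psd_def
  proof (intro conjI allI)
    show "transpose A = A"
      using assms by (simp add: spd_def)
    show "0 \<le> v \<bullet> (A *v v)" for v
      using assms by (cases "v = 0") (auto simp: spd_def intro: less_imp_le)
  qed
  note S = psd_sqrt_works[OF this]
  have "invertible (psd_sqrt A)"
    using spd_invertible[OF assms] S(2) by (metis det_mul invertible_det_nz mult_zero_left)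
  moreover have "(psd_sqrt A *v x) \<bullet> (psd_sqrt A *v x) = x \<bullet> (A *v x)" for x
    by (simp only: symmetric_matrix_inner[OF S(1)] matrix_vector_mul_assoc S(2))
  ultimately show ?thesis
    using that S by blast
qed

lemma spd_det_pos:
  fixes A :: "real^'m^'m"
  assumes "spd A"
  shows "0 < det A"
proof -
  obtain S where "transpose S = S" and S: "S ** S = A" "invertible S"
    by (rule spd_sqrt[OF assms]) (rule that)
  then have "det A = (det S)\<^sup>2" "det S \<noteq> 0"
    by (auto simp: det_mul power2_eq_square invertible_det_nz)
  then show ?thesis
    by simp
qed

text \<open>
  With \<open>A = S\<^sup>2\<close>, the trace of \<open>A\<close> is the squared Frobenius norm of \<open>S\<close>, which bounds how far \<open>S\<close> stretches
  vectors. The arithmetic-geometric mean would improve the bound by \<open>n^n\<close>; the constants of the theorem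
  correspond to the bound given here.
\<close>

lemma spd_det_le_trace_power:
  fixes A :: "real^'m^'m"
  assumes "spd A"
  shows "det A \<le> trace A ^ CARD('m)"
proof -
  obtain S where S: "transpose S = S" "S ** S = A" "invertible S"
    "\<And>x. (S *v x) \<bullet> (S *v x) = x \<bullet> (A *v x)"
    by (rule spd_sqrt[OF assms]) (rule that)
  have tr: "trace A = (\<Sum>i\<in>UNIV. (norm (S $ i))\<^sup>2)"
  proof -
    have "A = S ** transpose S"
      using S(1,2) by simp
    then show ?thesis
      by (simp add: matrix_mult_transpose_dot_row trace_def row_def power2_norm_eq_inner vec_nth_inverse)
  qed
  then have tr0: "0 \<le> trace A"
    by (simp add: sum_nonneg)
  have "norm (S *v x) \<le> sqrt (trace A) * norm x" for x
  proof (rule power2_le_imp_le)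
    have "(norm (S *v x))\<^sup>2 = (\<Sum>i\<in>UNIV. (S $ i \<bullet> x)\<^sup>2)"
      by (simp add: norm_vec_def L2_set_def matrix_vector_mul_component sum_nonneg)
    also have "\<dots> \<le> (\<Sum>i\<in>UNIV. (norm (S $ i))\<^sup>2 * (norm x)\<^sup>2)"
      using Cauchy_Schwarz_ineq by (intro sum_mono) (simp add: power2_norm_eq_inner)
    also have "\<dots> = (sqrt (trace A) * norm x)\<^sup>2"
      using tr0 by (simp add: tr power_mult_distrib sum_distrib_right)
    finally show "(norm (S *v x))\<^sup>2 \<le> (sqrt (trace A) * norm x)\<^sup>2" .
    show "0 \<le> sqrt (trace A) * norm x"
      using tr0 by simp
  qed
  then have "\<bar>det S\<bar> \<le> sqrt (trace A) ^ CARD('m)"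
    by (rule abs_det_le_power)
  then have "\<bar>det S\<bar>\<^sup>2 \<le> (sqrt (trace A) ^ CARD('m))\<^sup>2"
    by (intro power_mono) auto
  then show ?thesis
    using tr0 by (simp add: S(2)[symmetric] det_mul power2_eq_square flip: power_mult_distrib)
qed

text \<open>
  With \<open>A = S\<^sup>2\<close> and \<open>B = R\<^sup>2\<close>, the hypothesis says that \<open>S R\<^sup>-\<^sup>1\<close> stretches vectors by at most \<open>sqrt c\<close>.
\<close>

lemma spd_det_mono:
  fixes A B :: "real^'m^'m"
  assumes A: "spd A" and B: "spd B" and c: "0 \<le> c"
    and le: "\<And>x. x \<bullet> (A *v x) \<le> c * (x \<bullet> (B *v x))"
  shows "det A \<le> c ^ CARD('m) * det B"
proof -
  obtain S where S: "transpose S = S" "S ** S = A" "invertible S"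
    "\<And>x. (S *v x) \<bullet> (S *v x) = x \<bullet> (A *v x)"
    by (rule spd_sqrt[OF A]) (rule that)
  obtain R where R: "transpose R = R" "R ** R = B" "invertible R"
    "\<And>x. (R *v x) \<bullet> (R *v x) = x \<bullet> (B *v x)"
    by (rule spd_sqrt[OF B]) (rule that)
  let ?T = "S ** matrix_inv R"
  have "norm (?T *v x) \<le> sqrt c * norm x" for x
  proof -
    let ?y = "matrix_inv R *v x"
    have x: "R *v ?y = x"
      by (simp add: matrix_vector_mul_assoc matrix_inv_inverse R(3))
    have "(?T *v x) \<bullet> (?T *v x) = ?y \<bullet> (A *v ?y)"
      by (simp add: S(4) flip: matrix_vector_mul_assoc)
    also have "\<dots> \<le> c * (x \<bullet> x)"
      using le[of ?y] R(4)[of ?y] by (simp add: x)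
    finally show ?thesis
      by (simp add: norm_eq_sqrt_inner flip: real_sqrt_mult)
  qed
  then have "\<bar>det ?T\<bar> \<le> sqrt c ^ CARD('m)"
    by (rule abs_det_le_power)
  then have "\<bar>det ?T\<bar>\<^sup>2 \<le> (sqrt c ^ CARD('m))\<^sup>2"
    by (intro power_mono) auto
  also have "(sqrt c ^ CARD('m))\<^sup>2 = c ^ CARD('m)"
    using c by (simp add: power2_eq_square flip: power_mult_distrib)
  also have "\<bar>det ?T\<bar>\<^sup>2 = det A / det B"
    by (simp add: det_mul det_matrix_inv R(3) power2_eq_square flip: S(2) R(2))
  finally show ?thesis
    using spd_det_pos[OF B] by (simp add: field_simps)
qed

section \<open>Barycentric gradients and altitudes\<close>

text \<open>
  The gradient of the \<open>i\<close>-th barycentric coordinate of the simplex spanned by 0 (the vertex \<open>None\<close>) and the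
  coordinate vectors: the \<open>k\<close>-th coordinate for \<open>Some k\<close>, and 1 minus the sum of all coordinates for \<open>None\<close>.
\<close>

definition bary_gradient :: "'n option \<Rightarrow> real^'n" where
  "bary_gradient i = (case i of None \<Rightarrow> (\<chi> j. - 1) | Some k \<Rightarrow> axis k 1)"

lemma sum_UNIV_option:
  fixes f :: "'n::finite option \<Rightarrow> 'b::comm_monoid_add"
  shows "(\<Sum>i\<in>UNIV. f i) = f None + (\<Sum>j\<in>UNIV. f (Some j))"
proof -
  have "(\<Sum>i\<in>UNIV. f i) = (\<Sum>i\<in>insert None (range Some). f i)"
    by (simp only: UNIV_option_conv)
  also have "\<dots> = f None + (\<Sum>i\<in>range Some. f i)"
    by (subst sum.insert) auto
  also have "(\<Sum>i\<in>range Some. f i) = (\<Sum>j\<in>UNIV. f (Some j))"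
    by (subst sum.reindex) (auto simp: o_def)
  finally show ?thesis .
qed

lemma sum_bary_gradient:
  "(\<Sum>i\<in>UNIV. bary_gradient i) = (0 :: real^'n)"
proof -
  have "(\<Sum>k\<in>UNIV. axis k (1::real)) = (\<chi> i::'n. 1)"
    by (simp add: vec_eq_iff axis_def)
  then show ?thesis
    unfolding sum_UNIV_option by (simp add: bary_gradient_def vec_eq_iff)
qed

text \<open>
  The vector \<open>g = E A\<^sup>-\<^sup>1 u\<close> is the gradient of the \<open>i\<close>-th barycentric coordinate of \<open>w\<close>: the linear form \<open>p \<mapsto> g \<bullet> p\<close>
  is constant on the face opposite to vertex \<open>i\<close> and larger by 1 at the vertex. By Cauchy-Schwarz the distance is at
  least \<open>1 / |g|\<close>, and \<open>|g|\<^sup>2 = u \<bullet> A\<^sup>-\<^sup>1 u\<close>.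
\<close>

lemma altitude_ge:
  fixes w :: "'n::finite option \<Rightarrow> real^'d"
  defines "A \<equiv> transpose (edge_matrix w) ** edge_matrix w"
  assumes spd: "spd A"
  shows "1 / sqrt (bary_gradient i \<bullet> (matrix_inv A *v bary_gradient i)) \<le> altitude w i"
proof -
  let ?u = "bary_gradient i"
  let ?E = "edge_matrix w"
  define p where "p = matrix_inv A *v ?u"
  define g where "g = ?E *v p"
  have gE: "g \<bullet> (?E *v y) = ?u \<bullet> y" for y
  proof -
    have "g \<bullet> (?E *v y) = (A *v p) \<bullet> y"
      unfolding g_def A_def using matrix_inner_transpose[of "transpose ?E" "?E *v p" y]
      by (simp add: matrix_vector_mul_assoc del: transpose_matrix_vector)
    also have "A *v p = ?u"
      unfolding p_def by (simp add: matrix_vector_mul_assoc matrix_inv_inverse spd_invertible[OF spd])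
    finally show ?thesis .
  qed
  have norm_g: "norm g = sqrt (?u \<bullet> (matrix_inv A *v ?u))"
    using gE[of p] by (simp add: norm_eq_sqrt_inner g_def p_def)
  have edge: "g \<bullet> w (Some j) = g \<bullet> w None + ?u $ j" for j
    using gE[of "axis j 1"] by (simp add: edge_matrix_mult_axis inner_diff_right inner_axis)
  define c where "c = g \<bullet> w i - 1"
  have "g \<bullet> w k = c" if "k \<noteq> i" for k
  proof (cases i)
    case None
    with that show ?thesis
      using edge by (cases k) (auto simp: c_def bary_gradient_def)
  next
    case (Some l)
    with that show ?thesis
      using edge[of l] edge by (cases k) (auto simp: c_def bary_gradient_def axis_def)
  qed
  then have "affine hull (w ` (UNIV - {i})) \<subseteq> {p. g \<bullet> p = c}"
    by (intro hull_minimal affine_hyperplane) auto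
  then have far: "1 \<le> norm g * dist (w i) p" if "p \<in> affine hull (w ` (UNIV - {i}))" for p
    using that norm_cauchy_schwarz[of g "w i - p"] by (auto simp: c_def dist_norm inner_diff_right)
  have "(UNIV - {i} :: 'n option set) \<noteq> {}"
    by (cases i) auto
  then have ne: "affine hull (w ` (UNIV - {i})) \<noteq> {}"
    by simp
  then have "norm g \<noteq> 0"
    using far by fastforce
  then have "1 / norm g \<le> dist (w i) p" if "p \<in> affine hull (w ` (UNIV - {i}))" for p
    using far[OF that] by (simp add: field_simps)
  then show ?thesis
    unfolding altitude_def infdist_def norm_g[symmetric] using ne by (simp only: if_False) (rule cINF_greatest)
qed

text \<open>
  The gradients sum to zero, so each is minus the sum of the \<open>n\<close> others, and Cauchy-Schwarz bounds its square by
  \<open>n\<close> times the sum of their squares. The gain \<open>1 + 1 / n = d / (d - 1)\<close> over the trivial bound enters the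
  constants with the power \<open>q\<close>.
\<close>

lemma bary_gradient_norm_le_sum:
  fixes A :: "real^'n^'n"
  assumes spd: "spd A"
  defines "Q \<equiv> \<lambda>i. bary_gradient i \<bullet> (A *v bary_gradient i)"
  shows "(1 + 1 / real CARD('n)) * Q i \<le> (\<Sum>k\<in>UNIV. Q k)"
proof -
  obtain S where S: "transpose S = S" "S ** S = A" "invertible S"
    "\<And>x. (S *v x) \<bullet> (S *v x) = x \<bullet> (A *v x)"
    by (rule spd_sqrt[OF spd]) (rule that)
  let ?s = "\<lambda>k. S *v bary_gradient k"
  have Q: "Q k = (norm (?s k))\<^sup>2" for k
    by (simp add: Q_def S(4) power2_norm_eq_inner)
  have "(\<Sum>k\<in>UNIV. ?s k) = 0"
    by (simp add: sum_bary_gradient flip: linear_sum[OF matrix_vector_mul_linear])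
  then have "?s i = - (\<Sum>k\<in>UNIV - {i}. ?s k)"
    by (simp add: sum.remove[of UNIV i] eq_neg_iff_add_eq_0)
  then have "norm (?s i) \<le> (\<Sum>k\<in>UNIV - {i}. norm (?s k))"
    by (simp add: norm_sum)
  then have "(norm (?s i))\<^sup>2 \<le> (\<Sum>k\<in>UNIV - {i}. norm (?s k))\<^sup>2"
    by (rule power_mono) simp
  also have "\<dots> \<le> (\<Sum>k\<in>UNIV - {i}. (norm (?s k))\<^sup>2) * card (UNIV - {i})"
    by (rule sum_squared_le_sum_of_squares)
  also have "card (UNIV - {i}) = CARD('n)"
    by (simp add: card_Diff_singleton card_UNIV_option)
  finally have "Q i \<le> (\<Sum>k\<in>UNIV - {i}. Q k) * CARD('n)"
    by (simp add: Q)
  moreover have "(\<Sum>k\<in>UNIV. Q k) = Q i + (\<Sum>k\<in>UNIV - {i}. Q k)"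
    by (simp add: sum.remove)
  ultimately show ?thesis
    by (simp add: field_simps)
qed

lemma trace_le_bary_gradient:
  fixes A :: "real^'n^'n"
  assumes "\<And>i. bary_gradient i \<bullet> (A *v bary_gradient i) \<le> m"
  shows "trace A \<le> real CARD('n) * m"
proof -
  have "A $ j $ j \<le> m" for j
    using assms[of "Some j"] by (simp add: bary_gradient_def matrix_vector_mult_basis column_def inner_axis')
  then show ?thesis
    unfolding trace_def using sum_bounded_above[of UNIV "\<lambda>j. A $ j $ j" m] by simp
qed

section \<open>The equilateral reference simplex\<close>

lemma equilateral_gram:
  fixes \<xi> :: "'n::finite option \<Rightarrow> real^'n"
  assumes "\<And>i j. i \<noteq> j \<Longrightarrow> dist (\<xi> i) (\<xi> j) = s"
  shows "transpose (edge_matrix \<xi>) ** edge_matrix \<xi> = (s\<^sup>2 / 2) *\<^sub>R (\<chi> i j. if i = j then 2 else 1)"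
proof -
  let ?e = "\<lambda>j. \<xi> (Some j) - \<xi> None"
  have col: "column j (edge_matrix \<xi>) = ?e j" for j
    by (simp add: column_def edge_matrix_def vec_eq_iff)
  have n: "norm (?e j) = s" for j
    using assms[of "Some j" None] by (simp add: dist_norm)
  have "?e i \<bullet> ?e j = s\<^sup>2 / 2" if "i \<noteq> j" for i j
    using assms[of "Some i" "Some j"] that dot_norm_neg[of "?e i" "?e j"] by (simp add: n dist_norm)
  moreover have "?e i \<bullet> ?e i = s\<^sup>2" for i
    using n[of i] by (simp flip: power2_norm_eq_inner)
  ultimately show ?thesis
    by (simp add: matrix_mult_transpose_dot_column col vec_eq_iff)
qed

text \<open>
  The second factor is the identity plus the all-ones matrix. The trace against the identity gives the
  terms of the coordinate vectors, the sum of all entries of \<open>A\<close> gives that of \<open>None\<close>.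
\<close>

lemma trace_mult_equilateral_gram:
  fixes A :: "real^'n^'n"
  shows "trace (A ** (\<chi> i j. if i = j then 2 else 1)) = (\<Sum>i\<in>UNIV. bary_gradient i \<bullet> (A *v bary_gradient i))"
proof -
  have "trace (A ** (\<chi> i j. if i = j then 2 else 1)) = (\<Sum>i\<in>UNIV. \<Sum>k\<in>UNIV. A $ i $ k * (if k = i then 2 else 1))"
    by (simp add: trace_def matrix_matrix_mult_def)
  also have "\<dots> = (\<Sum>i\<in>UNIV. \<Sum>k\<in>UNIV. A $ i $ k + (if k = i then A $ i $ k else 0))"
    by (intro sum.cong) auto
  also have "\<dots> = (\<Sum>i\<in>UNIV. \<Sum>k\<in>UNIV. A $ i $ k) + (\<Sum>i\<in>UNIV. A $ i $ i)"
    by (simp add: sum.distrib)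
  also have "(\<Sum>i\<in>UNIV. \<Sum>k\<in>UNIV. A $ i $ k) = bary_gradient None \<bullet> (A *v bary_gradient None)"
    by (simp add: bary_gradient_def inner_vec_def matrix_vector_mult_def sum_negf)
  also have "(\<Sum>i\<in>UNIV. A $ i $ i) = (\<Sum>i\<in>UNIV. bary_gradient (Some i) \<bullet> (A *v bary_gradient (Some i)))"
    by (simp add: bary_gradient_def matrix_vector_mult_basis column_def inner_axis')
  finally show ?thesis
    by (simp add: sum_UNIV_option)
qed

text \<open>
  The matrix is the identity plus \<open>e e\<^sup>T\<close> with \<open>e\<close> the vector of ones, of length \<open>sqrt n\<close>. An orthogonal map taking an axis
  to the direction of \<open>e\<close> makes it diagonal, with \<open>n + 1\<close> in one place and 1 in the others.
\<close>

lemma det_equilateral_gram: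
  "det (\<chi> i j. if i = j then 2 else 1 :: real^'n^'n) = real CARD('n) + 1"
proof -
  let ?A = "\<chi> i j. if i = j then 2 else 1 :: real^'n^'n"
  let ?ones = "(\<chi> j. 1) :: real^'n"
  have "norm ?ones = sqrt (real CARD('n))"
    by (simp add: norm_vec_def L2_set_def)
  then have "norm ?ones = norm (sqrt (real CARD('n)) *\<^sub>R axis undefined 1 :: real^'n)"
    by (simp add: norm_axis_1)
  note eq = this[symmetric]
  have "\<exists>R. orthogonal_matrix R \<and> R *v (sqrt (real CARD('n)) *\<^sub>R axis undefined 1) = ?ones"
  proof (rule orthogonal_transformation_exists[OF eq])
    fix f :: "real^'n \<Rightarrow> real^'n"
    assume f: "orthogonal_transformation f" "f (sqrt (real CARD('n)) *\<^sub>R axis undefined 1) = ?ones"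
    have "matrix f *v x = f x" for x
      using f(1) by (simp add: matrix_works orthogonal_transformation_linear)
    moreover have "orthogonal_matrix (matrix f)"
      using f(1) by (simp add: orthogonal_transformation_matrix)
    ultimately show ?thesis
      using f(2) by (intro exI[of _ "matrix f"]) simp
  qed
  then obtain R where R: "orthogonal_matrix R"
    and ones: "R *v (sqrt (real CARD('n)) *\<^sub>R axis undefined 1) = ?ones"
    by blast
  have 1: "sqrt (real CARD('n)) * R $ i $ undefined = 1" for i
    using ones by (simp add: matrix_vector_mult_scaleR matrix_vector_mult_basis vec_eq_iff column_def)
  have col: "real CARD('n) * (R $ i $ undefined * R $ j $ undefined) = 1" for i j
  proof -
    have "real CARD('n) * (R $ i $ undefined * R $ j $ undefined)
        = (sqrt (real CARD('n)) * R $ i $ undefined) * (sqrt (real CARD('n)) * R $ j $ undefined)"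
      by simp
    also have "\<dots> = 1"
      by (simp only: 1 mult_1)
    finally show ?thesis .
  qed
  define D where "D = (\<chi> i j. if i = j then (if i = undefined then real CARD('n) + 1 else 1) else 0 :: real^'n^'n)"
  have orth: "(\<Sum>k\<in>UNIV. R $ i $ k * R $ j $ k) = (if i = j then 1 else 0)" for i j
    using R by (auto simp: orthogonal_matrix_def matrix_matrix_mult_def transpose_def vec_eq_iff mat_def)
  have "?A $ i $ j = (R ** D ** transpose R) $ i $ j" for i j
  proof -
    have "(R ** D ** transpose R) $ i $ j
        = (\<Sum>k\<in>UNIV. (if k = undefined then real CARD('n) + 1 else 1) * (R $ i $ k * R $ j $ k))"
      by (simp add: matrix_matrix_mult_def transpose_def D_def if_distrib[of "\<lambda>x. _ * x"] mult_ac cong: if_cong)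
    also have "\<dots> = (\<Sum>k\<in>UNIV. R $ i $ k * R $ j $ k
        + (if k = undefined then real CARD('n) * (R $ i $ k * R $ j $ k) else 0))"
      by (intro sum.cong) (auto simp: algebra_simps)
    also have "\<dots> = (if i = j then 1 else 0) + 1"
      by (simp add: sum.distrib orth col)
    finally show ?thesis
      by simp
  qed
  then have "?A = R ** D ** transpose R"
    by (simp add: vec_eq_iff)
  then have "det ?A = det D * (det R * det R)"
    by (simp add: det_mul)
  also have "det R * det R = 1"
    using det_orthogonal_matrix[OF R] by auto
  also have "det D = (\<Prod>i\<in>UNIV. D $ i $ i)"
    by (rule det_diagonal) (simp add: D_def)
  also have "\<dots> = real CARD('n) + 1"
    by (simp add: D_def)
  finally show ?thesis
    by simp
qed

section \<open>Estimates on one element\<close>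

lemma inner_gram:
  fixes E :: "real^'n^'d" and B :: "real^'d^'d"
  shows "x \<bullet> ((transpose E ** B ** E) *v y) = (E *v x) \<bullet> (B *v (E *v y))"
  by (simp only: matrix_inner_transpose matrix_vector_mul_assoc matrix_mul_assoc)

lemma spd_gram_if_area_pos:
  fixes v :: "'n::finite option \<Rightarrow> real^'d"
  assumes "CARD('n) \<le> CARD('d)" "0 < simplex_area v"
  shows "spd (transpose (edge_matrix v) ** edge_matrix v)"
proof -
  let ?E = "edge_matrix v"
  let ?G = "transpose ?E ** ?E"
  have "det ?G \<noteq> 0"
    using assms(2) unfolding simplex_area_eq_gram_det[OF assms(1)] by auto
  then have ker: "x = 0" if "?G *v x = 0" for x
    using that matrix_left_invertible_ker[of ?G] invertible_left_inverse[of ?G]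
    by (auto simp: invertible_det_nz)
  have "0 < x \<bullet> (?G *v x)" if "x \<noteq> 0" for x
  proof -
    have "?E *v x \<noteq> 0"
      using ker[of x] that by (metis matrix_vector_mul_assoc matrix_vector_mult_0_right)
    then show ?thesis
      using inner_gram[of x ?E "mat 1" x] by simp
  qed
  then show ?thesis
    by (simp add: spd_def matrix_transpose_mul)
qed

text \<open>
  \<open>K\<close> is the Gram matrix of the edges in the inner product given by \<open>B\<close>, and the bounds on \<open>B\<close> compare it with the
  Euclidean Gram matrix \<open>G\<close>.
\<close>

lemma metric_gram:
  fixes v :: "'n::finite option \<Rightarrow> real^'d" and B :: "real^'d^'d"
  defines "G \<equiv> transpose (edge_matrix v) ** edge_matrix v"
  defines "K \<equiv> transpose (edge_matrix v) ** B ** edge_matrix v"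
  assumes dim: "CARD('n) \<le> CARD('d)" and area: "0 < simplex_area v"
    and sym: "transpose B = B"
    and lo: "\<And>x. m_lo * (x \<bullet> x) \<le> x \<bullet> (B *v x)" and "0 < m_lo"
    and up: "\<And>x. x \<bullet> (B *v x) \<le> m_up * (x \<bullet> x)" and "0 \<le> m_up"
  shows "spd K" "det K \<le> m_up ^ CARD('n) * det G"
proof -
  let ?E = "edge_matrix v"
  have G: "spd G"
    unfolding G_def by (rule spd_gram_if_area_pos[OF dim area])
  have xG: "x \<bullet> (G *v x) = (?E *v x) \<bullet> (?E *v x)" for x
    using inner_gram[of x ?E "mat 1" x] by (simp add: G_def)
  have xK: "x \<bullet> (K *v x) = (?E *v x) \<bullet> (B *v (?E *v x))" for x
    unfolding K_def by (rule inner_gram)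
  have "transpose K = K"
    by (simp add: K_def matrix_transpose_mul sym matrix_mul_assoc)
  moreover have "0 < x \<bullet> (K *v x)" if "x \<noteq> 0" for x
  proof -
    have "0 < m_lo * (x \<bullet> (G *v x))"
      using G that \<open>0 < m_lo\<close> by (simp add: spd_def)
    then show ?thesis
      using lo[of "?E *v x"] by (simp add: xG xK)
  qed
  ultimately show "spd K"
    by (simp add: spd_def)
  then show "det K \<le> m_up ^ CARD('n) * det G"
    using up G \<open>0 \<le> m_up\<close> by (intro spd_det_mono) (auto simp: xG xK)
qed

text \<open>
  The altitudes in the metric are those of the image of the simplex under the root of the averaged metric, and \<open>K\<close> is
  the Gram matrix of that image.
\<close>

lemma element_altitude:
  fixes v :: "'n::finite option \<Rightarrow> real^'d" and M :: "real^'d \<Rightarrow> real^'d^'d"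
  defines "K \<equiv> transpose (edge_matrix v) ** average_metric M v ** edge_matrix v"
  assumes K: "spd K" and psd: "psd (average_metric M v)"
    and max: "\<And>i. bary_gradient i \<bullet> (matrix_inv K *v bary_gradient i) \<le> m" and "0 < m"
  shows "1 / sqrt m \<le> metric_min_altitude M v"
proof -
  define R where "R = psd_sqrt (average_metric M v)"
  have R: "transpose R = R" "R ** R = average_metric M v"
    unfolding R_def using psd_sqrt_works[OF psd] by auto
  let ?w = "\<lambda>j. R *v v j"
  have "edge_matrix ?w *v axis j 1 = (R ** edge_matrix v) *v axis j 1" for j
    by (simp add: edge_matrix_mult_axis matrix_vector_mult_diff_distrib flip: matrix_vector_mul_assoc)
  then have "edge_matrix ?w = R ** edge_matrix v"
    by (simp add: vec_eq_iff matrix_vector_mult_basis column_def)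
  then have "transpose (edge_matrix ?w) ** edge_matrix ?w = transpose (edge_matrix v) ** (transpose R ** R) ** edge_matrix v"
    by (simp add: matrix_transpose_mul matrix_mul_assoc)
  then have gram: "transpose (edge_matrix ?w) ** edge_matrix ?w = K"
    by (simp add: R K_def)
  have "1 / sqrt m \<le> altitude ?w i" for i
  proof -
    have "bary_gradient i \<noteq> (0 :: real^'n)"
      by (cases i) (auto simp: bary_gradient_def vec_eq_iff axis_def)
    then have "0 < bary_gradient i \<bullet> (matrix_inv K *v bary_gradient i)"
      using spd_matrix_inv[OF K] by (simp add: spd_def)
    then have "1 / sqrt m \<le> 1 / sqrt (bary_gradient i \<bullet> (matrix_inv K *v bary_gradient i))"
      using max[of i] \<open>0 < m\<close> by (intro divide_left_mono) auto
    also have "\<dots> \<le> altitude ?w i"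
      using altitude_ge[of ?w i] K by (simp add: gram)
    finally show ?thesis .
  qed
  then show ?thesis
    by (simp add: metric_min_altitude_def min_altitude_def R_def)
qed

text \<open>
  The number \<open>h\<close> is half the squared side; the last equation is the volume of an equilateral simplex.
\<close>

lemma reference_simplex:
  fixes \<xi> :: "'n::finite option \<Rightarrow> real^'n"
  assumes "equilateral \<xi>" and vol: "0 < simplex_volume \<xi>"
  obtains h where "0 < h"
    "transpose (edge_matrix \<xi>) ** edge_matrix \<xi> = h *\<^sub>R (\<chi> i j. if i = j then 2 else 1)"
    "h ^ CARD('n) * (real CARD('n) + 1) = (fact CARD('n) * simplex_volume \<xi>)\<^sup>2"
proof -
  obtain s where s: "\<And>i j. i \<noteq> j \<Longrightarrow> dist (\<xi> i) (\<xi> j) = s"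
    using assms(1) by (auto simp: equilateral_def)
  have gram: "transpose (edge_matrix \<xi>) ** edge_matrix \<xi> = (s\<^sup>2 / 2) *\<^sub>R (\<chi> i j. if i = j then 2 else 1)"
    by (rule equilateral_gram) (rule s)
  have "0 \<noteq> det (edge_matrix \<xi>)"
    using vol by (auto simp: simplex_volume_eq_det)
  define A where "A = (\<chi> i j. if i = j then 2 else 1 :: real^'n^'n)"
  have "det ((s\<^sup>2 / 2) *\<^sub>R A) = (s\<^sup>2 / 2) ^ CARD('n) * det A"
  proof -
    have "(s\<^sup>2 / 2) *\<^sub>R A = (\<chi> i. (s\<^sup>2 / 2) *s (A $ i))"
      by (simp add: vec_eq_iff)
    then show ?thesis
      using det_rows_mul[of "\<lambda>_. s\<^sup>2 / 2" "\<lambda>i. A $ i"] by simp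
  qed
  then have "(det (edge_matrix \<xi>))\<^sup>2 = (s\<^sup>2 / 2) ^ CARD('n) * (real CARD('n) + 1)"
    using arg_cong[OF gram, of det] det_equilateral_gram[where 'n='n]
    by (simp add: det_mul power2_eq_square flip: A_def)
  moreover have "(fact CARD('n) * simplex_volume \<xi>)\<^sup>2 = (det (edge_matrix \<xi>))\<^sup>2"
    by (simp add: simplex_volume_eq_det)
  moreover have "0 < s\<^sup>2 / 2"
  proof -
    have "s = 0 \<Longrightarrow> (det (edge_matrix \<xi>))\<^sup>2 = 0"
      using calculation(1) by (simp add: power_0_left)
    then show ?thesis
      using \<open>0 \<noteq> det (edge_matrix \<xi>)\<close> by auto
  qed
  ultimately show ?thesis
    using gram by (intro that[of "s\<^sup>2 / 2"]) auto
qed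

text \<open>
  The pullback metric is \<open>K\<close> in the coordinates of the reference simplex. In the area element the determinant of the
  reference edges cancels, which leaves the area of the element in the metric.
\<close>

lemma pullback_metric_inverse:
  fixes \<xi> :: "'n::finite option \<Rightarrow> real^'n" and v :: "'n option \<Rightarrow> real^'d"
    and M :: "real^'d \<Rightarrow> real^'d^'d"
  defines "K \<equiv> transpose (edge_matrix v) ** average_metric M v ** edge_matrix v"
  assumes K: "spd K" and vol: "0 < simplex_volume \<xi>"
  shows "spd (matrix_inv (pullback_metric \<xi> M v))"
    and "matrix_inv (pullback_metric \<xi> M v) = edge_matrix \<xi> ** matrix_inv K ** transpose (edge_matrix \<xi>)"
    and "simplex_volume \<xi> * sqrt (det (pullback_metric \<xi> M v)) = sqrt (det K) / fact CARD('n)"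
proof -
  let ?X = "edge_matrix \<xi>"
  let ?Y = "matrix_inv ?X"
  have "det ?X \<noteq> 0"
    using vol by (auto simp: simplex_volume_eq_det)
  then have X: "invertible ?X"
    by (simp add: invertible_det_nz)
  have A: "pullback_metric \<xi> M v = transpose ?Y ** K ** ?Y"
    by (simp add: pullback_metric_def affine_jacobian_def K_def matrix_transpose_mul matrix_mul_assoc)
  have "?X ** matrix_inv K ** transpose ?X ** (transpose ?Y ** K ** ?Y)
      = ?X ** (matrix_inv K ** (transpose (?Y ** ?X) ** K)) ** ?Y"
    by (simp add: matrix_transpose_mul matrix_mul_assoc)
  also have "\<dots> = mat 1"
    by (simp add: matrix_inv_inverse X spd_invertible[OF K])
  finally show J: "matrix_inv (pullback_metric \<xi> M v) = ?X ** matrix_inv K ** transpose ?X"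
    unfolding A by (rule matrix_inv_unique_left)
  have "spd (pullback_metric \<xi> M v)"
    unfolding spd_def
  proof (intro conjI allI impI)
    show "transpose (pullback_metric \<xi> M v) = pullback_metric \<xi> M v"
      using K by (simp add: A matrix_transpose_mul spd_def matrix_mul_assoc)
    fix x :: "real^'n" assume "x \<noteq> 0"
    have "?X *v (?Y *v x) = x"
      by (simp add: matrix_vector_mul_assoc matrix_inv_inverse X)
    then have "?Y *v x \<noteq> 0"
      using \<open>x \<noteq> 0\<close> by force
    then show "0 < x \<bullet> (pullback_metric \<xi> M v *v x)"
      using K by (simp add: A inner_gram spd_def)
  qed
  then show "spd (matrix_inv (pullback_metric \<xi> M v))"
    by (rule spd_matrix_inv)
  have "det (pullback_metric \<xi> M v) = det K / (det ?X)\<^sup>2"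
    by (simp add: A det_mul det_matrix_inv X power2_eq_square)
  then show "simplex_volume \<xi> * sqrt (det (pullback_metric \<xi> M v)) = sqrt (det K) / fact CARD('n)"
    using \<open>det ?X \<noteq> 0\<close> by (simp add: simplex_volume_eq_det real_sqrt_divide)
qed

text \<open>
  Here \<open>b\<close> is the reciprocal of the length of the longest barycentric gradient, in the metric of the element. It
  bounds all altitudes from below, and through it the area \<open>V\<close> in the metric and the trace of \<open>J\<close> are
  bounded from below. Using \<open>b\<close> in place of the minimum altitude itself means that altitudes need only be
  estimated from below.
\<close>

lemma element_estimates:
  fixes \<xi> :: "'n::finite option \<Rightarrow> real^'n" and v :: "'n option \<Rightarrow> real^'d"
    and M :: "real^'d \<Rightarrow> real^'d^'d"
  defines "A \<equiv> pullback_metric \<xi> M v"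
  defines "V \<equiv> simplex_volume \<xi> * sqrt (det A)"
  assumes dim: "CARD('d) = CARD('n) + 1" and area: "0 < simplex_area v"
    and sym: "transpose (average_metric M v) = average_metric M v"
    and lo: "\<And>x. m_lo * (x \<bullet> x) \<le> x \<bullet> (average_metric M v *v x)" and "0 < m_lo"
    and up: "\<And>x. x \<bullet> (average_metric M v *v x) \<le> m_up * (x \<bullet> x)" and m_up: "1 \<le> m_up"
    and vol: "0 < simplex_volume \<xi>"
    and h: "0 < h" "transpose (edge_matrix \<xi>) ** edge_matrix \<xi> = h *\<^sub>R (\<chi> i j. if i = j then 2 else 1)"
  obtains b where "0 < b" "b \<le> metric_min_altitude M v"
    "b ^ CARD('n) / (fact CARD('n) * real CARD('n) powr (real CARD('n) / 2)) \<le> V"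
    "V \<le> m_up powr (real CARD('d) / 2) * simplex_area v"
    "h * (1 + 1 / real CARD('n)) / b\<^sup>2 \<le> trace (matrix_inv A)"
    "spd (matrix_inv A)"
proof -
  define K where "K = transpose (edge_matrix v) ** average_metric M v ** edge_matrix v"
  let ?C = "matrix_inv K" and ?n = "CARD('n)"
  define Q where "Q i = bary_gradient i \<bullet> (?C *v bary_gradient i)" for i
  have dim': "CARD('n) \<le> CARD('d)"
    using dim by simp
  have K: "spd K" "det K \<le> m_up ^ ?n * det (transpose (edge_matrix v) ** edge_matrix v)"
    using metric_gram[OF dim' area sym lo \<open>0 < m_lo\<close> up] m_up by (auto simp: K_def)
  have psd: "psd (average_metric M v)"
    unfolding psd_def
  proof (intro conjI allI)
    show "0 \<le> x \<bullet> (average_metric M v *v x)" for x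
      using lo[of x] \<open>0 < m_lo\<close> by (smt (verit) inner_ge_zero mult_nonneg_nonneg)
  qed (rule sym)
  note pb = pullback_metric_inverse[OF K(1)[unfolded K_def] vol, folded K_def A_def]
  have C: "spd ?C"
    by (rule spd_matrix_inv[OF K(1)])
  obtain i where i: "\<And>k. Q k \<le> Q i"
  proof -
    have "Max (range Q) \<in> range Q"
      by (intro Max_in) auto
    then obtain i where "Max (range Q) = Q i"
      by blast
    then show thesis
      using that[of i] Max_ge[of "range Q"] by force
  qed
  have "bary_gradient i \<noteq> (0 :: real^'n)"
    by (cases i) (auto simp: bary_gradient_def vec_eq_iff axis_def)
  then have Qi: "0 < Q i"
    using C by (simp add: Q_def spd_def)
  define b where "b = 1 / sqrt (Q i)"
  have b: "0 < b" "Q i = 1 / b\<^sup>2"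
    using Qi by (auto simp: b_def power_divide)
  have alt: "b \<le> metric_min_altitude M v"
    unfolding b_def using element_altitude[OF K(1)[unfolded K_def] psd, folded K_def] i Qi
    by (simp add: Q_def)
  have detK: "0 < det K"
    by (rule spd_det_pos[OF K(1)])
  have V: "V = sqrt (det K) / fact ?n"
    unfolding V_def by (rule pb(3))
  have lowV: "b ^ ?n / (fact ?n * real ?n powr (real ?n / 2)) \<le> V"
  proof -
    have "1 / det K \<le> trace ?C ^ ?n"
      using spd_det_le_trace_power[OF C] by (simp add: det_matrix_inv spd_invertible[OF K(1)])
    also have "\<dots> \<le> (real ?n / b\<^sup>2) ^ ?n"
    proof (rule power_mono)
      show "trace ?C \<le> real ?n / b\<^sup>2"
        using trace_le_bary_gradient[of ?C "Q i"] i by (simp add: Q_def[symmetric] b(2))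
      have "0 \<le> ?C $ j $ j" for j
        using C spd_def[of ?C] by (metis less_eq_real_def axis_eq_0_iff inner_axis' matrix_vector_mult_basis
            column_def vec_lambda_beta mult_1 zero_neq_one real_inner_1_left)
      then show "0 \<le> trace ?C"
        by (simp add: trace_def sum_nonneg)
    qed
    finally have "(b\<^sup>2) ^ ?n / real ?n ^ ?n \<le> det K"
      using detK b(1) by (simp add: field_simps)
    then have "sqrt ((b\<^sup>2) ^ ?n / real ?n ^ ?n) \<le> sqrt (det K)"
      by (rule real_sqrt_le_mono)
    also have "sqrt ((b\<^sup>2) ^ ?n / real ?n ^ ?n) = b ^ ?n / real ?n powr (real ?n / 2)"
      using b(1) by (simp add: real_sqrt_divide real_sqrt_power powr_half_sqrt_powr powr_realpow)
    finally show ?thesis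
      by (simp add: V field_simps)
  qed
  have upV: "V \<le> m_up powr (real CARD('d) / 2) * simplex_area v"
  proof -
    let ?G = "transpose (edge_matrix v) ** edge_matrix v"
    have "sqrt (det K) \<le> sqrt (m_up ^ ?n * det ?G)"
      using K(2) by (rule real_sqrt_le_mono)
    also have "\<dots> = m_up powr (real ?n / 2) * sqrt (det ?G)"
      using m_up by (simp add: real_sqrt_mult powr_half_sqrt_powr powr_realpow)
    also have "\<dots> \<le> m_up powr (real CARD('d) / 2) * sqrt (det ?G)"
      using m_up spd_det_pos[OF spd_gram_if_area_pos[OF dim' area]] by (intro mult_right_mono powr_mono) (auto simp: dim)
    finally show ?thesis
      by (simp add: V simplex_area_eq_gram_det[OF dim'] divide_right_mono)
  qed
  have "trace (matrix_inv A) = trace (?C ** (transpose (edge_matrix \<xi>) ** edge_matrix \<xi>))"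
    unfolding pb(2) by (metis matrix_mul_assoc trace_mul_sym)
  also have "\<dots> = h * (\<Sum>k\<in>UNIV. Q k)"
    unfolding h(2) Q_def trace_mult_equilateral_gram[symmetric]
    by (simp add: trace_def matrix_matrix_mult_def sum_distrib_left mult_ac)
  finally have tr: "trace (matrix_inv A) = h * (\<Sum>k\<in>UNIV. Q k)" .
  have "h * ((1 + 1 / real ?n) * Q i) \<le> h * (\<Sum>k\<in>UNIV. Q k)"
    using bary_gradient_norm_le_sum[OF C, of i] h(1) by (simp add: Q_def mult_left_mono)
  then have "h * (1 + 1 / real ?n) / b\<^sup>2 \<le> trace (matrix_inv A)"
    by (simp add: tr b(2))
  then show ?thesis
    using that[OF b(1) alt lowV upV] pb(1) by blast
qed

section \<open>The explicit constants\<close>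

lemma altitude_const_pos:
  assumes "0 < \<alpha>" "2 \<le> d"
  shows "0 < altitude_const \<alpha> q d"
proof -
  have "real d - 1 \<noteq> 0"
    using assms(2) by simp
  then show ?thesis
    unfolding altitude_const_def powr_gt_zero using assms by simp
qed

text \<open>
  Substituting the bounds of \<open>V\<close> and \<open>tr\<close> into the energy bound gives \<open>c b^(n - 2 q) \<le> X\<close>, and \<open>h\<close> is known
  from \<open>N\<close>. All quantities are positive, and in their logarithms the hypotheses and the claim are linear.
\<close>

lemma altitude_bound_from_energy:
  fixes n d :: nat and \<alpha> q h b V tr X N :: real
  assumes d: "d = n + 1" and n: "0 < n" and q: "q > real n / 2" and pos: "0 < \<alpha>" "0 < h" "0 < b" "0 < N"
    and href: "h ^ n * (real n + 1) = (fact n / N)\<^sup>2"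
    and V: "b ^ n / (fact n * real n powr (real n / 2)) \<le> V"
    and tr: "h * (1 + 1 / real n) / b\<^sup>2 \<le> tr"
    and energy: "\<alpha> * V * tr powr q \<le> X"
  shows "altitude_const \<alpha> q d * X powr (- 1 / (2 * q - real d + 1))
      * N powr (- (2 * q) / ((real d - 1) * (2 * q - real d + 1))) \<le> b"
proof -
  let ?n = "real n" and ?F = "ln (fact n :: real)" and ?r = "2 * q - real n"
  have r: "?r > 0"
    using q by simp
  have n': "0 < ?n"
    using n by simp
  have V0: "0 < V"
    using V pos(3) n' by (intro less_le_trans[OF _ V]) simp
  have tr0: "0 < tr"
    using pos n' by (intro less_le_trans[OF _ tr]) (simp add: add_pos_pos)
  have X: "0 < X"
    using V0 tr0 pos(1) by (intro less_le_trans[OF _ energy]) simp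
  have "ln (b ^ n / (fact n * ?n powr (?n / 2))) \<le> ln V"
    using V V0 pos n' by (subst ln_le_cancel_iff) simp_all
  then have lnV: "?n * ln b - ?F - ?n / 2 * ln ?n \<le> ln V"
    using pos(3) n' by (simp add: ln_div ln_mult ln_realpow ln_powr)
  have one_plus: "1 + 1 / ?n = (?n + 1) / ?n"
    using n' by (simp add: field_simps)
  have "ln (h * ((?n + 1) / ?n) / b\<^sup>2) \<le> ln tr"
    using tr[unfolded one_plus] tr0 pos n' by (subst ln_le_cancel_iff) simp_all
  then have lntr: "ln h + ln (?n + 1) - ln ?n - 2 * ln b \<le> ln tr"
    using pos n' by (simp add: ln_div ln_mult ln_realpow)
  have "ln (\<alpha> * V * tr powr q) \<le> ln X"
    using energy X V0 tr0 pos(1) by (subst ln_le_cancel_iff) simp_all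
  then have lnX: "ln \<alpha> + ln V + q * ln tr \<le> ln X"
    using V0 tr0 pos(1) by (simp add: ln_mult ln_powr)
  have "ln (h ^ n * (?n + 1)) = ln ((fact n / N)\<^sup>2)"
    using href by simp
  then have "?n * ln h + ln (?n + 1) = 2 * (?F - ln N)"
    using pos n' by (simp add: ln_mult ln_div ln_realpow)
  then have lnh: "ln h = (2 * ?F - 2 * ln N - ln (?n + 1)) / ?n"
    using n' by (simp add: field_simps)
  have "q * (ln h + ln (?n + 1) - ln ?n - 2 * ln b) \<le> q * ln tr"
    using lntr q n' by (intro mult_left_mono) auto
  then have "ln \<alpha> + (?n * ln b - ?F - ?n / 2 * ln ?n) + q * (ln h + ln (?n + 1) - ln ?n - 2 * ln b) \<le> ln X"
    using lnV lnX by linarith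
  then have key: "ln \<alpha> - ?F - (?n / 2 + q) * ln ?n + q * ln h + q * ln (?n + 1) - ln X \<le> ?r * ln b"
    by (simp add: algebra_simps)
  define R where "R = ?r"
  have R: "R > 0"
    using r by (simp add: R_def)
  let ?lhs = "altitude_const \<alpha> q d * X powr (- 1 / (2 * q - real d + 1))
      * N powr (- (2 * q) / ((real d - 1) * (2 * q - real d + 1)))"
  have d': "real d = ?n + 1"
    by (simp add: d)
  have e: "2 * q - real d + 1 = R" "real d - 1 = ?n" "real d - 2 = ?n - 1" "d - 1 = n"
    by (simp_all add: d' R_def d)
  have "ln (altitude_const \<alpha> q d)
      = (ln \<alpha> + q * (?n - 1) / ?n * ln (?n + 1) + R / ?n * ?F - (?n + 2 * q) / 2 * ln ?n) / R"
    unfolding altitude_const_def e unfolding d'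
    using pos n' R by (simp add: ln_mult ln_div ln_powr)
  then have "ln ?lhs = (ln \<alpha> + q * (?n - 1) / ?n * ln (?n + 1) + R / ?n * ?F - (?n + 2 * q) / 2 * ln ?n) / R
      - ln X / R - 2 * q / (?n * R) * ln N"
    unfolding e using pos X altitude_const_pos[of \<alpha> d q] n d by (simp add: ln_mult ln_powr)
  also have "\<dots> = (ln \<alpha> + q * (?n - 1) / ?n * ln (?n + 1) + R / ?n * ?F - (?n + 2 * q) / 2 * ln ?n
      - ln X - 2 * q / ?n * ln N) / R"
    by (simp add: diff_divide_distrib)
  also have "ln \<alpha> + q * (?n - 1) / ?n * ln (?n + 1) + R / ?n * ?F - (?n + 2 * q) / 2 * ln ?n
      - ln X - 2 * q / ?n * ln N
    = ln \<alpha> - ?F - (?n / 2 + q) * ln ?n + q * ln h + q * ln (?n + 1) - ln X"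
    unfolding lnh R_def using n' by (simp add: field_simps)
  also have "\<dots> / R \<le> ln b"
    using key R by (simp add: R_def pos_divide_le_eq mult.commute)
  finally show ?thesis
    using pos X altitude_const_pos[of \<alpha> d q] n d by (subst (asm) ln_le_cancel_iff) auto
qed

text \<open>
  The \<open>n\<close>-th power of the altitude bound, inserted into the lower bound of \<open>V\<close>.
\<close>

lemma area_bound_from_altitude_bound:
  fixes n d :: nat and \<alpha> q b V X N m_up area :: real
  assumes d: "d = n + 1" and n: "0 < n" and pos: "0 < \<alpha>" "0 < N" "0 < X" "0 < m_up"
    and b: "altitude_const \<alpha> q d * X powr (- 1 / (2 * q - real d + 1))
      * N powr (- (2 * q) / ((real d - 1) * (2 * q - real d + 1))) \<le> b"
    and V: "b ^ n / (fact n * real n powr (real n / 2)) \<le> V" "V \<le> m_up powr (real d / 2) * area"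
  shows "area_const \<alpha> q d * X powr (- (real d - 1) / (2 * q - real d + 1))
      * N powr (- (2 * q) / (2 * q - real d + 1)) * m_up powr (- real d / 2) \<le> area"
proof -
  let ?c = "altitude_const \<alpha> q d" and ?r = "2 * q - real d + 1"
  let ?B = "?c * X powr (- 1 / ?r) * N powr (- (2 * q) / ((real d - 1) * ?r))"
  let ?D = "fact n * real n powr (real n / 2)"
  have n': "real d - 1 = real n" "d - 1 = n"
    by (simp_all add: d)
  have Xn: "(X powr (- 1 / ?r)) ^ n = X powr (- (real d - 1) / ?r)"
    using pos by (simp add: powr_power n')
  have Nn: "(N powr (- (2 * q) / ((real d - 1) * ?r))) ^ n = N powr (- (2 * q) / ?r)"
    using pos n by (simp add: powr_power n')
  have D: "0 < ?D"
    using n by simp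
  have "0 \<le> ?B"
    using altitude_const_pos[of \<alpha> d q] pos n d by simp
  then have "?B ^ n \<le> b ^ n"
    using b by (intro power_mono) auto
  then have "?B ^ n / ?D \<le> b ^ n / ?D"
    using D by (intro divide_right_mono) auto
  then have "?B ^ n / ?D \<le> m_up powr (real d / 2) * area"
    using V by linarith
  then have "?B ^ n / ?D * m_up powr (- real d / 2) \<le> m_up powr (real d / 2) * area * m_up powr (- real d / 2)"
    by (rule mult_right_mono) simp
  also have "\<dots> = area"
    using pos by (simp add: powr_minus)
  also have "?B ^ n / ?D * m_up powr (- real d / 2) = area_const \<alpha> q d * X powr (- (real d - 1) / ?r)
      * N powr (- (2 * q) / ?r) * m_up powr (- real d / 2)"
    unfolding power_mult_distrib Xn Nn area_const_def unfolding n' by (simp add: mult_ac)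
  finally show ?thesis .
qed

section \<open>Decay of the meshing function\<close>

lemma sum_axis_components:
  fixes h :: "('a::comm_monoid_add)^'v"
  shows "(\<Sum>i\<in>UNIV. axis i (h $ i)) = h"
proof (rule vec_eq_iff[THEN iffD2], rule allI)
  fix j
  have "(\<Sum>i\<in>UNIV. axis i (h $ i)) $ j = (\<Sum>i\<in>UNIV. if j = i then h $ i else 0)"
    by (simp add: axis_def)
  then show "(\<Sum>i\<in>UNIV. axis i (h $ i)) $ j = h $ j"
    by simp
qed

lemma bounded_linear_axis: "bounded_linear (axis i :: 'a::real_normed_vector \<Rightarrow> 'a^'v)"
proof
  show "axis i (x + y) = axis i x + (axis i y :: 'a^'v)" for x y
    by (simp add: vec_eq_iff axis_def)
  show "axis i (r *\<^sub>R x) = r *\<^sub>R (axis i x :: 'a^'v)" for r x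
    by (simp add: vec_eq_iff axis_def)
  have "norm (axis i x :: 'a^'v) \<le> norm x * 1" for x
    using norm_vec_def[of "axis i x :: 'a^'v"] L2_set_le_sum[of UNIV "\<lambda>j. norm ((axis i x :: 'a^'v) $ j)"]
    by (simp add: axis_def if_distrib cong: if_cong)
  then show "\<exists>K. \<forall>x. norm (axis i x :: 'a^'v) \<le> norm x * K"
    by blast
qed

lemma gradient_eqI:
  fixes f :: "'a::real_inner \<Rightarrow> real"
  assumes "GDERIV f x :> D"
  shows "gradient f x = D"
  unfolding gradient_def
proof (rule the_equality)
  show "GDERIV f x :> D"
    by (rule assms)
next
  fix D' assume "GDERIV f x :> D'"
  then have "(\<lambda>h. h \<bullet> D') = (\<lambda>h. h \<bullet> D)"
    using assms unfolding gderiv_def by (rule has_derivative_unique)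
  then have "h \<bullet> D' = h \<bullet> D" for h
    by (rule fun_cong)
  then show "D' = D"
    by (metis vector_eq_ldot)
qed

text \<open>
  The restriction of \<open>F\<close> to the motion of one vertex has a gradient by Riesz representation of its derivative; the
  total derivative is the sum over the vertices.
\<close>

lemma total_derivative_vertex_gradient:
  fixes F :: "(real^'d)^'v \<Rightarrow> real"
  assumes F: "(F has_derivative F') (at y)"
  shows "F' h = (\<Sum>i\<in>UNIV. vertex_gradient F y i \<bullet> (h $ i))"
proof -
  have lin: "linear F'"
    using F by (rule has_derivative_linear)
  have "F' (axis i z) = vertex_gradient F y i \<bullet> z" for i z
  proof -
    let ?\<phi> = "\<lambda>z. \<chi> j. if j = i then z else y $ j"
    have \<phi>: "?\<phi> z = y + axis i (z - y $ i)" for z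
      by (simp add: vec_eq_iff axis_def)
    have "(?\<phi> has_derivative axis i) (at (y $ i))"
      unfolding \<phi> by (auto intro!: derivative_eq_intros bounded_linear.has_derivative[OF bounded_linear_axis])
    moreover have "?\<phi> (y $ i) = y"
      by (simp add: vec_eq_iff)
    ultimately have comp: "((\<lambda>z. F (?\<phi> z)) has_derivative (\<lambda>h. F' (axis i h))) (at (y $ i))"
      using F by (intro has_derivative_compose[of ?\<phi> "axis i" _ _ F F']) simp_all
    then have "linear (\<lambda>h. F' (axis i h))"
      by (rule has_derivative_linear)
    then have adj: "F' (axis i h) = h \<bullet> adjoint (\<lambda>h. F' (axis i h)) 1" for h
      using adjoint_works[of "\<lambda>h. F' (axis i h)" h 1] by simp
    then have "GDERIV (\<lambda>z. F (?\<phi> z)) (y $ i) :> adjoint (\<lambda>h. F' (axis i h)) 1"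
      using comp unfolding gderiv_def by (metis (no_types, lifting) ext)
    then have "vertex_gradient F y i = adjoint (\<lambda>h. F' (axis i h)) 1"
      unfolding vertex_gradient_def by (rule gradient_eqI)
    then show ?thesis
      using adj[of z] by (simp add: inner_commute)
  qed
  then have "(\<Sum>i\<in>UNIV. vertex_gradient F y i \<bullet> (h $ i)) = F' (\<Sum>i\<in>UNIV. axis i (h $ i))"
    by (simp add: linear_sum[OF lin])
  then show ?thesis
    by (simp add: sum_axis_components)
qed

lemma has_vector_derivative_componentwise:
  fixes x :: "real \<Rightarrow> 'a::real_normed_vector^'v"
  assumes "\<And>i. ((\<lambda>s. x s $ i) has_vector_derivative v i) (at t within T)"
  shows "(x has_vector_derivative (\<chi> i. v i)) (at t within T)"
proof -
  have "((\<lambda>s. \<Sum>i\<in>UNIV. axis i (x s $ i)) has_vector_derivative (\<Sum>i\<in>UNIV. axis i (v i))) (at t within T)"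
    by (intro has_vector_derivative_sum bounded_linear.has_vector_derivative[OF bounded_linear_axis] assms)
  moreover have "(\<Sum>i\<in>UNIV. axis i (v i)) = (\<chi> i. v i)"
    using sum_axis_components[of "\<chi> i. v i"] by simp
  ultimately show ?thesis
    by (simp add: sum_axis_components)
qed

text \<open>
  The pairing is \<open>|g|\<^sup>2 - (g \<bullet> n)\<^sup>2\<close>, where \<open>|n| \<le> 1\<close> also when the gradient of \<open>\<Phi>\<close> vanishes and \<open>n\<close> has the default
  value 0.
\<close>

lemma inner_projected_gradient_nonneg:
  "0 \<le> vertex_gradient F y i \<bullet> projected_gradient \<Phi> F y i"
proof -
  let ?g = "vertex_gradient F y i" and ?n = "unit_normal \<Phi> (y $ i)"
  have "norm ?n \<le> 1"
    by (cases "gradient \<Phi> (y $ i) = 0") (simp_all add: unit_normal_def)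
  then have "\<bar>?g \<bullet> ?n\<bar> \<le> norm ?g"
    using Cauchy_Schwarz_ineq2[of ?g ?n] mult_left_mono[of "norm ?n" 1 "norm ?g"] by simp
  then have "\<bar>?g \<bullet> ?n\<bar>\<^sup>2 \<le> (norm ?g)\<^sup>2"
    by (rule power_mono) simp
  then have "(?g \<bullet> ?n)\<^sup>2 \<le> ?g \<bullet> ?g"
    by (simp only: power2_norm_eq_inner power2_abs)
  then show ?thesis
    by (simp add: projected_gradient_def Let_def inner_diff_right power2_eq_square)
qed

text \<open>
  Each vertex moves against the projection of its own gradient, and a vector has a nonnegative inner product with
  its projection.
\<close>

lemma projected_gradient_flow_derivative:
  fixes F :: "(real^'d)^'v \<Rightarrow> real" and x :: "real \<Rightarrow> (real^'d)^'v"
  assumes F: "F differentiable (at (x t))"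
    and flow: "\<And>i. ((\<lambda>s. x s $ i) has_vector_derivative
                   - c i *\<^sub>R projected_gradient \<Phi> F (x t) i) (at t within T)"
    and c: "\<And>i. 0 \<le> c i"
  shows "\<exists>D\<le>0. ((\<lambda>s. F (x s)) has_real_derivative D) (at t within T)"
proof -
  obtain F' where F': "(F has_derivative F') (at (x t))"
    using F by (auto simp: differentiable_def)
  define V where "V = (\<chi> i. - c i *\<^sub>R projected_gradient \<Phi> F (x t) i)"
  have "(x has_vector_derivative V) (at t within T)"
    unfolding V_def by (intro has_vector_derivative_componentwise flow)
  then have "((\<lambda>s. F (x s)) has_derivative (\<lambda>h. F' (h *\<^sub>R V))) (at t within T)"
    unfolding has_vector_derivative_def using F' by (rule has_derivative_compose)
  then have "((\<lambda>s. F (x s)) has_real_derivative F' V) (at t within T)"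
    using linear_scale[OF has_derivative_linear[OF F']]
    by (simp add: has_field_derivative_def mult_commute_abs)
  moreover have "F' V \<le> 0"
    unfolding total_derivative_vertex_gradient[OF F'] V_def
    using c inner_projected_gradient_nonneg by (auto intro!: sum_nonpos mult_nonneg_nonneg)
  ultimately show ?thesis
    by blast
qed

lemma nonincreasing_if_derivative_nonpos:
  fixes f :: "real \<Rightarrow> real"
  assumes "a \<le> b" "{a..b} \<subseteq> T"
    and der: "\<And>s. s \<in> {a..b} \<Longrightarrow> \<exists>D\<le>0. (f has_real_derivative D) (at s within T)"
  shows "f b \<le> f a"
proof (cases "a = b")
  case False
  then have "a < b"
    using assms(1) by simp
  from less_imp_le[OF this] show ?thesis
  proof (rule DERIV_nonpos_imp_decreasing_open)
    show "\<exists>D. (f has_real_derivative D) (at s) \<and> D \<le> 0" if s: "a < s" "s < b" for s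
    proof -
      obtain D where D: "D \<le> 0" "(f has_real_derivative D) (at s within T)"
        using der[of s] s by auto
      have "(f has_real_derivative D) (at s within {a<..<b})"
        using assms(2) by (intro has_field_derivative_subset[OF D(2)]) auto
      then show ?thesis
        using D s at_within_open[of s "{a<..<b}"] by auto
    qed
    have "continuous (at s within {a..b}) f" if s: "s \<in> {a..b}" for s
    proof -
      obtain D where "(f has_real_derivative D) (at s within T)"
        using der[OF s] by auto
      then have "(f has_real_derivative D) (at s within {a..b})"
        using assms(2) by (rule has_field_derivative_subset)
      then show ?thesis
        by (rule DERIV_continuous)
    qed
    then show "continuous_on {a..b} f"
      by (simp add: continuous_on_eq_continuous_within)
  qed
qed simp

section \<open>Meshes of positive area\<close>

lemma continuous_on_simplex_area:
  fixes x :: "real \<Rightarrow> (real^'d)^'v" and conn :: "'e \<Rightarrow> 'n::finite option \<Rightarrow> 'v"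
  assumes "CARD('n) \<le> CARD('d)" "continuous_on T x"
  shows "continuous_on T (\<lambda>t. simplex_area (element conn (x t) k))"
proof -
  have coord: "continuous_on T (\<lambda>t. x t $ i $ j)" for i j
    by (intro continuous_on_component assms(2))
  show ?thesis
    unfolding simplex_area_eq_gram_det[OF assms(1)] det_def matrix_matrix_mult_def transpose_def
      edge_matrix_def element_def vec_lambda_beta vector_minus_component
    by (intro continuous_on_divide continuous_on_real_sqrt continuous_on_sum continuous_on_mult
        continuous_on_prod continuous_on_diff continuous_on_const coord ballI fact_nonzero)
qed

text \<open>
  If \<open>a\<close> were to become nonpositive, it would have to cross the level \<open>c / 2\<close>. At the first time at which it reaches
  this level it has been positive throughout, so it is at least \<open>c\<close> there, a contradiction.
\<close>

lemma positive_if_positivity_improves: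
  fixes a :: "real \<Rightarrow> real"
  assumes cont: "continuous_on {0..t} a" and c: "0 < c"
    and lower: "\<And>s. s \<in> {0..t} \<Longrightarrow> \<forall>r\<in>{0..s}. 0 < a r \<Longrightarrow> c \<le> a s"
    and t: "0 \<le> t" and a0: "0 < a 0"
  shows "\<forall>s\<in>{0..t}. 0 < a s"
proof (rule ccontr)
  assume "\<not> ?thesis"
  then obtain u where u: "u \<in> {0..t}" "a u \<le> 0"
    by (auto simp: not_less)
  define Z where "Z = {0..t} \<inter> a -` {..c / 2}"
  have "closed Z"
    unfolding Z_def by (rule continuous_closed_preimage[OF cont]) auto
  then have "compact Z"
    using compact_Int_closed[of "{0..t}" Z] by (simp add: Z_def Int_absorb1 Int_assoc[symmetric])
  moreover have "Z \<noteq> {}"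
    using u c by (auto simp: Z_def)
  ultimately obtain z where z: "z \<in> Z" "\<And>s. s \<in> Z \<Longrightarrow> z \<le> s"
    using compact_attains_inf[of Z] by blast
  have zt: "0 \<le> z" "z \<le> t" "a z \<le> c / 2"
    using z(1) by (auto simp: Z_def)
  have before: "c / 2 < a s" if "0 \<le> s" "s < z" for s
    using z(2)[of s] that zt by (force simp: Z_def not_le[symmetric])
  have "c \<le> a 0"
    using lower[of 0] a0 t by simp
  have "a z = c / 2"
  proof -
    have "\<exists>s\<ge>0. s \<le> z \<and> a s = c / 2"
      using \<open>c \<le> a 0\<close> c zt by (intro IVT2') (auto intro: continuous_on_subset[OF cont])
    then show ?thesis
      using before zt by (metis less_irrefl order_le_less)
  qed
  then have "\<forall>r\<in>{0..z}. 0 < a r"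
    using before c by (smt (verit) atLeastAtMost_iff half_gt_zero)
  then have "c \<le> a z"
    using lower[of z] zt by simp
  then show False
    using zt(3) c by simp
qed

text \<open>
  Coercivity bounds the energy below by the sum over the elements of \<open>V (\<alpha> tr^q - \<beta>)\<close>. The terms with \<open>\<beta>\<close> add up to
  at most \<open>\<beta>\<close> times the area of the mesh in the metric, which accounts for the second summand of \<open>X\<close>, so a
  single term \<open>\<alpha> V tr^q\<close> is at most \<open>X\<close>.
\<close>

lemma mesh_lower_bounds:
  fixes M :: "real^'d \<Rightarrow> real^'d^'d" and G :: "real^'n^'n \<Rightarrow> real \<Rightarrow> real"
    and \<xi> :: "'n::finite option \<Rightarrow> real^'n" and conn :: "'e::finite \<Rightarrow> 'n option \<Rightarrow> 'v::finite"
    and y :: "(real^'d)^'v" and m_lo m_up \<alpha> \<beta> q I\<^sub>0 S :: real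
  defines "d \<equiv> CARD('d)" and "N \<equiv> real CARD('e)"
  defines "X \<equiv> I\<^sub>0 + \<beta> * m_up powr (real d / 2) * S"
  assumes dim: "CARD('d) = CARD('n) + 1"
    and meas: "M \<in> borel_measurable borel"
    and sym: "\<And>k z. z \<in> flat_simplex (element conn y k) \<Longrightarrow> transpose (M z) = M z"
    and bounds: "\<And>k z. z \<in> flat_simplex (element conn y k) \<Longrightarrow>
      loewner_le (mat m_lo) (M z) \<and> loewner_le (M z) (mat m_up)"
    and m: "0 < m_lo" "1 \<le> m_up"
    and coercive: "\<And>J. spd J \<Longrightarrow> G J (det J) \<ge> \<alpha> * trace J powr q - \<beta>"
    and params: "q > (real d - 1) / 2" "\<alpha> > 0" "\<beta> \<ge> 0"
    and reference: "equilateral \<xi>" "simplex_volume \<xi> = 1 / N"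
    and positive: "positive_areas conn y"
    and energy: "meshing_function \<xi> M G conn y \<le> I\<^sub>0"
    and mesh_area: "\<beta> > 0 \<Longrightarrow> (\<Sum>k\<in>UNIV. simplex_area (element conn y k)) \<le> S"
  shows "0 < X"
    and "altitude_const \<alpha> q d * X powr (- 1 / (2 * q - real d + 1))
           * N powr (- (2 * q) / ((real d - 1) * (2 * q - real d + 1)))
         \<le> metric_min_altitude M (element conn y k)"
    and "area_const \<alpha> q d * X powr (- (real d - 1) / (2 * q - real d + 1))
           * N powr (- (2 * q) / (2 * q - real d + 1)) * m_up powr (- real d / 2)
         \<le> simplex_area (element conn y k)"
proof -
  let ?el = "element conn y" and ?n = "CARD('n)"
  define A where "A k = pullback_metric \<xi> M (?el k)" for k
  define V where "V k = simplex_volume \<xi> * sqrt (det (A k))" for k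
  define tr where "tr k = trace (matrix_inv (A k))" for k
  have N: "0 < N"
    by (simp add: N_def)
  then have vol: "0 < simplex_volume \<xi>"
    by (simp add: reference)
  obtain h where h: "0 < h"
    "transpose (edge_matrix \<xi>) ** edge_matrix \<xi> = h *\<^sub>R (\<chi> i j. if i = j then 2 else 1)"
    "h ^ ?n * (real ?n + 1) = (fact ?n * simplex_volume \<xi>)\<^sup>2"
    by (rule reference_simplex[OF reference(1) vol]) (rule that)
  have area: "0 < simplex_area (?el k)" for k
    using positive by (simp add: positive_areas_def)
  have est: "\<exists>b>0. b \<le> metric_min_altitude M (?el k) \<and>
      b ^ ?n / (fact ?n * real ?n powr (real ?n / 2)) \<le> V k \<and>
      V k \<le> m_up powr (real d / 2) * simplex_area (?el k) \<and>
      h * (1 + 1 / real ?n) / b\<^sup>2 \<le> tr k \<and> spd (matrix_inv (A k))" for k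
  proof -
    have lo: "m_lo * (x \<bullet> x) \<le> x \<bullet> (M z *v x)" and up: "x \<bullet> (M z *v x) \<le> m_up * (x \<bullet> x)"
      if "z \<in> flat_simplex (?el k)" for x z
      using bounds[OF that] loewner_le_mat_iff[OF sym[OF that]] by auto
    note avg = average_metric_bounds[OF meas area sym lo up less_imp_le[OF m(1)]]
    show ?thesis
      unfolding A_def V_def tr_def d_def
      by (rule element_estimates[OF dim area avg(1) avg(2) m(1) avg(3) m(2) vol h(1,2)]) blast+
  qed
  have V0: "0 \<le> V k" for k
  proof -
    obtain b where "0 < b" "b ^ ?n / (fact ?n * real ?n powr (real ?n / 2)) \<le> V k"
      using est[of k] by blast
    then show ?thesis
      by (smt (verit) divide_nonneg_nonneg fact_ge_zero mult_nonneg_nonneg powr_ge_zero zero_le_power)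
  qed
  have "(\<Sum>k\<in>UNIV. V k * (\<alpha> * tr k powr q - \<beta>)) \<le> (\<Sum>k\<in>UNIV. V k * G (matrix_inv (A k)) (det (matrix_inv (A k))))"
    using est coercive V0 by (intro sum_mono mult_left_mono) (auto simp: tr_def)
  also have "\<dots> \<le> I\<^sub>0"
    using energy by (simp add: meshing_function_def Let_def V_def A_def)
  finally have "(\<Sum>k\<in>UNIV. \<alpha> * V k * tr k powr q) \<le> I\<^sub>0 + \<beta> * (\<Sum>k\<in>UNIV. V k)"
    by (simp add: algebra_simps sum.distrib sum_subtractf sum_distrib_left)
  also have "\<beta> * (\<Sum>k\<in>UNIV. V k) \<le> \<beta> * (m_up powr (real d / 2) * S)"
  proof (cases "\<beta> > 0")
    case True
    have "(\<Sum>k\<in>UNIV. V k) \<le> (\<Sum>k\<in>UNIV. m_up powr (real d / 2) * simplex_area (?el k))"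
      using est by (intro sum_mono) blast
    also have "\<dots> \<le> m_up powr (real d / 2) * S"
      using mesh_area[OF True] by (simp add: mult_left_mono flip: sum_distrib_left)
    finally show ?thesis
      using True by simp
  qed (use params in simp)
  finally have total: "(\<Sum>k\<in>UNIV. \<alpha> * V k * tr k powr q) \<le> X"
    by (simp add: X_def mult.assoc)
  have single: "\<alpha> * V k * tr k powr q \<le> X" for k
  proof -
    have "\<alpha> * V k * tr k powr q \<le> (\<Sum>k\<in>UNIV. \<alpha> * V k * tr k powr q)"
      using V0 params by (intro member_le_sum) auto
    then show ?thesis
      using total by simp
  qed
  have d: "d = ?n + 1" and n: "0 < ?n"
    using dim by (auto simp: d_def)
  have q: "real ?n / 2 < q"
    using params(1) d by simp
  have href: "h ^ ?n * (real ?n + 1) = (fact ?n / N)\<^sup>2"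
    using h(3) reference(2) by simp
  obtain b where b: "0 < b" "b \<le> metric_min_altitude M (?el k)"
      "b ^ ?n / (fact ?n * real ?n powr (real ?n / 2)) \<le> V k"
      "V k \<le> m_up powr (real d / 2) * simplex_area (?el k)"
      "h * (1 + 1 / real ?n) / b\<^sup>2 \<le> tr k"
    using est[of k] by blast
  show X: "0 < X"
  proof -
    have "0 < V k"
      using b(1,3) n by (smt (verit) divide_pos_pos fact_gt_zero mult_pos_pos of_nat_0_less_iff powr_gt_zero zero_less_power)
    moreover have "0 < tr k"
      using b(1,5) h(1) n by (smt (verit) divide_pos_pos mult_pos_pos of_nat_0_less_iff zero_less_power)
    ultimately show ?thesis
      using single[of k] params(2) by (smt (verit) mult_pos_pos powr_gt_zero)
  qed
  note alt = altitude_bound_from_energy[OF d n q params(2) h(1) b(1) N href b(3,5) single]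
  show "altitude_const \<alpha> q d * X powr (- 1 / (2 * q - real d + 1))
      * N powr (- (2 * q) / ((real d - 1) * (2 * q - real d + 1))) \<le> metric_min_altitude M (?el k)"
    using alt b(2) by linarith
  show "area_const \<alpha> q d * X powr (- (real d - 1) / (2 * q - real d + 1))
      * N powr (- (2 * q) / (2 * q - real d + 1)) * m_up powr (- real d / 2) \<le> simplex_area (?el k)"
    using m(2) by (intro area_bound_from_altitude_bound[OF d n params(2) N X _ alt b(3,4)]) simp
qed

section \<open>Lower bounds along the mesh trajectory\<close>

text \<open>
  The bounds at time \<open>t\<close> follow from positivity of the areas on the whole of \<open>[0, t]\<close>, because this is what makes
  the energy at time \<open>t\<close> at most the initial one. So positivity on \<open>[0, t]\<close> comes first, and its proof uses
  the bounds at the times up to which the areas are already known to be positive.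
\<close>

theorem theorem4p1:
  fixes \<Phi> :: "real^'d \<Rightarrow> real"
    and M :: "real^'d \<Rightarrow> real^'d^'d"
    and D :: "(real^'d) set"
    and m_lo m_up \<alpha> \<beta> q \<tau> :: real
    and G :: "real^'n^'n \<Rightarrow> real \<Rightarrow> real"
    and W :: "((real^'n^'n) \<times> real) set"
    and \<xi> :: "'n option \<Rightarrow> real^'n"
    and conn :: "'e::finite \<Rightarrow> 'n option \<Rightarrow> 'v::finite"
    and P :: "'v \<Rightarrow> (real^'d)^'v \<Rightarrow> real"
    and T :: "real set"
    and x :: "real \<Rightarrow> (real^'d)^'v"
  defines "S \<equiv> level_surface \<Phi>"
    and "I\<^sub>h \<equiv> meshing_function \<xi> M G conn"
    and "d \<equiv> CARD('d)"
    and "N \<equiv> CARD('e)"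
  assumes dim: "CARD('d) = CARD('n) + 1"
    and surface: "regular_hypersurface \<Phi>" "bounded S"
    \<comment> \<open>the metric tensor, on the surface and on the elements of the mesh\<close>
    and domain: "S \<subseteq> D" "\<And>t k. t \<in> T \<Longrightarrow> flat_simplex (element conn (x t) k) \<subseteq> D"
    and metric_measurable: "M \<in> borel_measurable borel"
    and metric_symmetric: "\<And>y. y \<in> D \<Longrightarrow> transpose (M y) = M y"
    and metric_bounds: "\<And>y. y \<in> D \<Longrightarrow> loewner_le (mat m_lo) (M y) \<and> loewner_le (M y) (mat m_up)"
    and m_lo: "0 < m_lo"
    \<comment> \<open>\<open>m_up\<close> is only an upper bound of \<open>M\<close>, so it can be enlarged to be at least 1\<close>
    and m_up: "1 \<le> m_up"
    \<comment> \<open>the meshing function\<close>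
    and G_smooth: "open W" "{(J, r). spd J \<and> 0 < r} \<subseteq> W" "smooth_on W (\<lambda>(J, r). G J r)"
    and coercive: "\<And>J. spd J \<Longrightarrow> G J (det J) \<ge> \<alpha> * trace J powr q - \<beta>"
    and params: "q > (real d - 1) / 2" "\<alpha> > 0" "\<beta> \<ge> 0"
    and reference: "equilateral \<xi>" "simplex_volume \<xi> = 1 / real N"
    \<comment> \<open>the mesh trajectory on its time interval\<close>
    and time: "is_interval T" "0 \<in> T" "T \<subseteq> {0..}"
    and mobility: "\<And>i y. 0 < P i y" "0 < \<tau>"
    and trajectory_continuous: "continuous_on T x"
    and on_surface: "\<And>t i. t \<in> T \<Longrightarrow> x t $ i \<in> S"
    and I\<^sub>h_differentiable:
      "\<And>t. t \<in> T \<Longrightarrow> positive_areas conn (x t) \<Longrightarrow> I\<^sub>h differentiable (at (x t))"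
    and moving_mesh_equation:
      "\<And>t i. t \<in> T \<Longrightarrow> positive_areas conn (x t) \<Longrightarrow>
         ((\<lambda>s. x s $ i) has_vector_derivative
            - (P i (x t) / \<tau>) *\<^sub>R projected_gradient \<Phi> I\<^sub>h (x t) i) (at t within T)"
    \<comment> \<open>the total area of the mesh does not exceed that of the surface\<close>
    and mesh_area: "\<And>t. t \<in> T \<Longrightarrow> \<beta> > 0 \<Longrightarrow>
         (\<Sum>k\<in>UNIV. simplex_area (element conn (x t) k)) \<le> surface_area S"
    and initial: "positive_areas conn (x 0)"
  shows "\<forall>t\<in>T. positive_areas conn (x t) \<and>
    (\<forall>k. metric_min_altitude M (element conn (x t) k)
           \<ge> altitude_const \<alpha> q d
             * (I\<^sub>h (x 0) + \<beta> * m_up powr (real d / 2) * surface_area S)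
                 powr (- 1 / (2 * q - real d + 1))
             * real N powr (- (2 * q) / ((real d - 1) * (2 * q - real d + 1)))
       \<and> simplex_area (element conn (x t) k)
           \<ge> area_const \<alpha> q d
             * (I\<^sub>h (x 0) + \<beta> * m_up powr (real d / 2) * surface_area S)
                 powr (- (real d - 1) / (2 * q - real d + 1))
             * real N powr (- (2 * q) / (2 * q - real d + 1))
             * m_up powr (- real d / 2))"
proof
  let ?area = "\<lambda>t k. simplex_area (element conn (x t) k)"
  let ?X = "I\<^sub>h (x 0) + \<beta> * m_up powr (real d / 2) * surface_area S"
  define lb where "lb = area_const \<alpha> q d * ?X powr (- (real d - 1) / (2 * q - real d + 1))
    * real N powr (- (2 * q) / (2 * q - real d + 1)) * m_up powr (- real d / 2)"
  fix t assume t: "t \<in> T"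
  have t0: "0 \<le> t" and sub: "{0..t} \<subseteq> T"
    using t time mem_is_interval_1_I[OF time(1) time(2) t] by auto
  have decay: "I\<^sub>h (x s) \<le> I\<^sub>h (x 0)" if s: "s \<in> {0..t}" and pos: "\<forall>r\<in>{0..s}. positive_areas conn (x r)" for s
  proof (rule nonincreasing_if_derivative_nonpos[of 0 s T "\<lambda>s. I\<^sub>h (x s)"])
    show "0 \<le> s" "{0..s} \<subseteq> T"
      using s sub by auto
    fix r assume r: "r \<in> {0..s}"
    then have "r \<in> T" "positive_areas conn (x r)"
      using s sub pos by auto
    then show "\<exists>D\<le>0. ((\<lambda>s. I\<^sub>h (x s)) has_real_derivative D) (at r within T)"
      using mobility
      by (intro projected_gradient_flow_derivative[OF I\<^sub>h_differentiable moving_mesh_equation])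
        (auto intro: less_imp_le)
  qed
  have bounds: "0 < ?X"
      "altitude_const \<alpha> q d * ?X powr (- 1 / (2 * q - real d + 1))
         * real N powr (- (2 * q) / ((real d - 1) * (2 * q - real d + 1)))
       \<le> metric_min_altitude M (element conn (x s) k)"
      "lb \<le> ?area s k"
    if s: "s \<in> {0..t}" and pos: "\<forall>r\<in>{0..s}. positive_areas conn (x r)" for s k
  proof -
    have sT: "s \<in> T"
      using s sub by auto
    have inD: "z \<in> D" if "z \<in> flat_simplex (element conn (x s) k)" for z k
      using domain(2)[OF sT] that by blast
    have "positive_areas conn (x s)"
      using s pos by auto
    note mb = mesh_lower_bounds[where conn = conn and y = "x s" and S = "surface_area S", OF dim metric_measurable
        metric_symmetric[OF inD] metric_bounds[OF inD] m_lo m_up coercive params[unfolded d_def]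
        reference[unfolded N_def] this decay[OF s pos, unfolded I\<^sub>h_def] mesh_area[OF sT]]
    show "0 < ?X"
      unfolding I\<^sub>h_def d_def by (rule mb(1))
    show "altitude_const \<alpha> q d * ?X powr (- 1 / (2 * q - real d + 1))
         * real N powr (- (2 * q) / ((real d - 1) * (2 * q - real d + 1)))
       \<le> metric_min_altitude M (element conn (x s) k)"
      unfolding I\<^sub>h_def d_def N_def by (rule mb(2))
    show "lb \<le> ?area s k"
      unfolding lb_def I\<^sub>h_def d_def N_def by (rule mb(3))
  qed
  \<comment> \<open>areas are never negative, so all of them are positive exactly when their product is\<close>
  define a where "a s = (\<Prod>k\<in>UNIV. ?area s k)" for s
  have a_pos: "0 < a s \<longleftrightarrow> positive_areas conn (x s)" for s
  proof -
    have "0 \<le> ?area s k" for k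
      by (simp add: simplex_area_def)
    then show ?thesis
      unfolding a_def positive_areas_def
      by (metis UNIV_I finite less_le prod_nonneg prod_pos prod_zero_iff)
  qed
  have X: "0 < ?X"
    using bounds(1)[of 0] initial t0 by simp
  have lb: "0 < lb"
  proof -
    have "2 \<le> d"
      using dim by (simp add: d_def)
    then show ?thesis
      using X m_up altitude_const_pos[of \<alpha> d q] params(2)
      by (simp add: lb_def area_const_def N_def)
  qed
  have "\<forall>s\<in>{0..t}. 0 < a s"
  proof (rule positive_if_positivity_improves[where c = "lb ^ N"])
    show "continuous_on {0..t} a"
      unfolding a_def using dim trajectory_continuous sub
      by (intro continuous_on_prod continuous_on_simplex_area) (auto intro: continuous_on_subset)
    show "lb ^ N \<le> a s" if s: "s \<in> {0..t}" and "\<forall>r\<in>{0..s}. 0 < a r" for s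
    proof -
      have "(\<Prod>k\<in>(UNIV :: 'e set). lb) \<le> a s"
        unfolding a_def using bounds(3)[OF s] that(2) lb by (intro prod_mono) (auto simp: a_pos)
      then show ?thesis
        by (simp add: N_def)
    qed
  qed (use lb t0 initial in \<open>simp_all add: a_pos\<close>)
  then have "\<forall>s\<in>{0..t}. positive_areas conn (x s)"
    by (simp add: a_pos)
  then show "positive_areas conn (x t) \<and>
    (\<forall>k. metric_min_altitude M (element conn (x t) k)
           \<ge> altitude_const \<alpha> q d
             * (I\<^sub>h (x 0) + \<beta> * m_up powr (real d / 2) * surface_area S)
                 powr (- 1 / (2 * q - real d + 1))
             * real N powr (- (2 * q) / ((real d - 1) * (2 * q - real d + 1)))
       \<and> simplex_area (element conn (x t) k)
           \<ge> area_const \<alpha> q d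
             * (I\<^sub>h (x 0) + \<beta> * m_up powr (real d / 2) * surface_area S)
                 powr (- (real d - 1) / (2 * q - real d + 1))
             * real N powr (- (2 * q) / (2 * q - real d + 1))
             * m_up powr (- real d / 2))"
    using bounds(2,3)[of t] t0 by (simp add: lb_def)
qed

end
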